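(* Let $F$ be a field of characteristic $0$. The kernel of the expansion map $\mathcal{E}_4\colon A_4\to B_4$ is generated as an $S_4$-module by the two defining identities for pre-Jordan algebras: $$PJ_1(x,y,z,u) = (x\circ y)\cdot(z\cdot u)+(y\circ z)\cdot(x\cdot u)+(z\circ x)\cdot(y\cdot u) - z\cdot[(x\circ y)\cdot u]-x\cdot[(y\circ z)\cdot u]-y\cdot[(z\circ x)\cdot u],$$ $$PJ_2(x,y,z,u) = x\cdot[y\cdot(z\cdot u)]+z\cdot[y\cdot(x\cdot u)]+[(x\circ z)\circ y]\cdot u - z\cdot[(x\circ y)\cdot u]-x\cdot[(y\circ z)\cdot u]-y\cdot[(z\circ x)\cdot u],$$ where $x\circ y = x\cdot y+y\cdot x$ and $x,y,z,u$ denote the four variables.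
   Context: A dendriform algebra over $F$ is a vector space with two bilinear operations $\succ,\prec$ satisfying, for all $x,y,z$: $(x\prec y)\prec z = x\prec(y\prec z)+x\prec(y\succ z)$; $(x\succ y)\prec z = x\succ(y\prec z)$; $x\succ(y\succ z) = (x\prec y)\succ z+(x\succ y)\succ z$. Let $A_n$ be the space of multilinear polynomials of degree $n$ in $n$ variables in the free nonassociative (nonunital) $F$-algebra with one bilinear operation $x\cdot y$ on these variables, and let $B_n$ be the space of multilinear elements of degree $n$ in the same variables in the free dendriform $F$-algebra on them. The expansion map $\mathcal{E}_n\colon A_n\to B_n$ is the linear map that replaces every occurrence of the product $x\cdot y$ by the pre-Jordan product $x\succ y+y\prec x$. The symmetric group $S_n$ acts on $A_n$ and $B_n$ by permuting the variables, and $\ker\mathcal{E}_n$ is the $S_n$-module of multilinear identities of degree $n$ satisfied by the pre-Jordan product. *)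

theory Defs
  imports "HOL-Library.Poly_Mapping" "HOL-Library.Multiset" "HOL.Vector_Spaces" "HOL.Hull"
begin

section \<open>Vector spaces with a prescribed basis\<close>

text \<open>The type \<open>'k \<Rightarrow>\<^sub>0 'f\<close> is the \<open>'f\<close>-vector space with basis \<open>single k 1\<close>. Its library
  multiplication is not used; the products below are the bilinear extensions of operations on
  the basis.\<close>

definition fv_scale :: "'f::field \<Rightarrow> ('k \<Rightarrow>\<^sub>0 'f) \<Rightarrow> ('k \<Rightarrow>\<^sub>0 'f)" where
  "fv_scale c p = Poly_Mapping.map ((*) c) p"

definition lin_ext :: "('f \<Rightarrow> 'a \<Rightarrow> 'a) \<Rightarrow> ('k \<Rightarrow> 'a) \<Rightarrow> ('k \<Rightarrow>\<^sub>0 'f::field) \<Rightarrow> 'a::ab_group_add" where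
  "lin_ext scale f p = (\<Sum>k\<in>Poly_Mapping.keys p. scale (Poly_Mapping.lookup p k) (f k))"

definition bilin_ext ::
  "('k \<Rightarrow> 'k \<Rightarrow> 'k) \<Rightarrow> ('k \<Rightarrow>\<^sub>0 'f::field) \<Rightarrow> ('k \<Rightarrow>\<^sub>0 'f) \<Rightarrow> ('k \<Rightarrow>\<^sub>0 'f)" where
  "bilin_ext b p q = lin_ext fv_scale (\<lambda>s. lin_ext fv_scale (\<lambda>t. Poly_Mapping.single (b s t) 1) q) p"

lemma lookup_fv_scale [simp]: "Poly_Mapping.lookup (fv_scale c p) k = c * Poly_Mapping.lookup p k"
  by (simp add: fv_scale_def Poly_Mapping.map.rep_eq when_def)

lemma fv_scale_single [simp]: "fv_scale c (Poly_Mapping.single k a) = Poly_Mapping.single k (c * a)"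
  by (rule poly_mapping_eqI) (simp add: lookup_single when_def)

lemma vector_space_fv: "vector_space fv_scale"
  by unfold_locales
    (auto intro!: poly_mapping_eqI simp: Poly_Mapping.lookup_add algebra_simps)

global_interpretation FV: vector_space fv_scale
  by (rule vector_space_fv)

lemma lin_ext_superset:
  assumes "vector_space scale" "finite S" "Poly_Mapping.keys p \<subseteq> S"
  shows "lin_ext scale f p = (\<Sum>k\<in>S. scale (Poly_Mapping.lookup p k) (f k))"
proof -
  interpret vector_space scale by fact
  show ?thesis
    unfolding lin_ext_def using assms(2,3)
    by (intro sum.mono_neutral_left) (auto simp: in_keys_iff)
qed

lemma lin_ext_single [simp]:
  assumes "vector_space scale"
  shows "lin_ext scale f (Poly_Mapping.single k a) = scale a (f k)"
proof -
  interpret vector_space scale by fact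
  show ?thesis
    by (subst lin_ext_superset[OF assms, where S = "{k}"]) auto
qed

lemma linear_lin_ext:
  assumes "vector_space scale"
  shows "Vector_Spaces.linear fv_scale scale (lin_ext scale f)"
proof -
  interpret V: vector_space scale by fact
  have "lin_ext scale f (p + q) = lin_ext scale f p + lin_ext scale f q" for p q
  proof -
    let ?S = "Poly_Mapping.keys p \<union> Poly_Mapping.keys q"
    have *: "finite ?S" by simp
    show ?thesis
      using lin_ext_superset[OF assms *, of p f] lin_ext_superset[OF assms *, of q f]
        lin_ext_superset[OF assms *, of "p + q" f] Poly_Mapping.keys_add[of p q]
      by (simp add: Poly_Mapping.lookup_add V.scale_left_distrib sum.distrib)
  qed
  moreover have "lin_ext scale f (fv_scale c p) = scale c (lin_ext scale f p)" for c p
    by (subst lin_ext_superset[OF assms, where S = "Poly_Mapping.keys p"])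
       (auto simp: in_keys_iff lin_ext_def V.scale_sum_right)
  ultimately show ?thesis
    using assms vector_space_fv unfolding linear_iff by blast
qed

lemma fv_expansion: "lin_ext fv_scale (\<lambda>k. Poly_Mapping.single k 1) p = p"
proof (rule poly_mapping_eqI)
  fix k
  have "Poly_Mapping.lookup (lin_ext fv_scale (\<lambda>k. Poly_Mapping.single k 1) p) k =
    (\<Sum>j\<in>Poly_Mapping.keys p. if j = k then Poly_Mapping.lookup p j else 0)"
    by (auto simp: lin_ext_def Poly_Mapping.lookup_sum lookup_single when_def intro!: sum.cong)
  also have "\<dots> = Poly_Mapping.lookup p k"
    by (simp add: in_keys_iff)
  finally show "Poly_Mapping.lookup (lin_ext fv_scale (\<lambda>k. Poly_Mapping.single k 1) p) k = \<dots>" .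
qed

lemma linear_eq_lin_ext:
  assumes "Vector_Spaces.linear fv_scale scale g"
  shows "g p = lin_ext scale (\<lambda>k. g (Poly_Mapping.single k 1)) p"
proof -
  interpret g: Vector_Spaces.linear fv_scale scale g by fact
  have "g p = g (lin_ext fv_scale (\<lambda>k. Poly_Mapping.single k 1) p)"
    by (simp only: fv_expansion)
  also have "\<dots> = lin_ext scale (\<lambda>k. g (Poly_Mapping.single k 1)) p"
    unfolding lin_ext_def by (simp only: g.sum g.scale)
  finally show ?thesis .
qed

lemma linear_bilin_ext_left: "Vector_Spaces.linear fv_scale fv_scale (\<lambda>p. bilin_ext b p q)"
  unfolding bilin_ext_def by (rule linear_lin_ext[OF vector_space_fv])

lemma linear_bilin_ext_right:
  fixes p :: "'k \<Rightarrow>\<^sub>0 'f::field"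
  shows "Vector_Spaces.linear fv_scale fv_scale (bilin_ext b p)"
proof -
  let ?F = "\<lambda>s. lin_ext fv_scale (\<lambda>t. Poly_Mapping.single (b s t) (1::'f))"
  have L: "Vector_Spaces.linear fv_scale fv_scale (?F s)" for s
    by (rule linear_lin_ext[OF vector_space_fv])
  have "bilin_ext b p (q + q') = bilin_ext b p q + bilin_ext b p q'" for q q'
    using L unfolding bilin_ext_def lin_ext_def[of _ _ p] linear_iff
    by (simp add: FV.scale_right_distrib sum.distrib)
  moreover have "bilin_ext b p (fv_scale c q) = fv_scale c (bilin_ext b p q)" for c q
    using L unfolding bilin_ext_def lin_ext_def[of _ _ p] linear_iff
    by (simp add: FV.scale_sum_right mult.commute)
  ultimately show ?thesis
    using vector_space_fv unfolding linear_iff by blast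
qed

lemma bilin_ext_single [simp]:
  "bilin_ext b (Poly_Mapping.single s a) (Poly_Mapping.single t c) =
   Poly_Mapping.single (b s t) (a * c)"
  by (simp add: bilin_ext_def vector_space_fv)


section \<open>The free nonassociative algebra\<close>

datatype 'v magma = Var 'v | Mul "'v magma" "'v magma"

primrec magma_vars :: "'v magma \<Rightarrow> 'v list" where
  "magma_vars (Var v) = [v]"
| "magma_vars (Mul s t) = magma_vars s @ magma_vars t"

primrec magma_eval :: "('a \<Rightarrow> 'a \<Rightarrow> 'a) \<Rightarrow> ('v \<Rightarrow> 'a) \<Rightarrow> 'v magma \<Rightarrow> 'a" where
  "magma_eval m f (Var v) = f v"
| "magma_eval m f (Mul s t) = m (magma_eval m f s) (magma_eval m f t)"

type_synonym ('v, 'f) free_na = "'v magma \<Rightarrow>\<^sub>0 'f"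

definition na_var :: "'v \<Rightarrow> ('v, 'f::field) free_na" where
  "na_var v = Poly_Mapping.single (Var v) 1"

definition na_mult :: "('v, 'f::field) free_na \<Rightarrow> ('v, 'f) free_na \<Rightarrow> ('v, 'f) free_na"
    (infixl \<open>\<cdot>\<close> 70) where
  "p \<cdot> q = bilin_ext Mul p q"

text \<open>The space \<open>A\<^sub>n\<close>. The type \<open>'v\<close> is the set of variables, so \<open>n\<close> is the cardinality of \<open>'v\<close>,
  and every variable has to occur exactly once in each monomial.\<close>

definition na_multilinear :: "('v, 'f::field) free_na set" where
  "na_multilinear =
    {p. \<forall>t\<in>Poly_Mapping.keys p. distinct (magma_vars t) \<and> set (magma_vars t) = UNIV}"

definition na_permute :: "('v \<Rightarrow> 'v) \<Rightarrow> ('v, 'f::field) free_na \<Rightarrow> ('v, 'f) free_na" where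
  "na_permute \<pi> = lin_ext fv_scale (\<lambda>t. Poly_Mapping.single (map_magma \<pi> t) 1)"

definition perm_submodule :: "('v, 'f::field) free_na set \<Rightarrow> bool" where
  "perm_submodule M \<longleftrightarrow>
    FV.subspace M \<and> (\<forall>\<pi>. bij \<pi> \<longrightarrow> (\<forall>p\<in>M. na_permute \<pi> p \<in> M))"

definition perm_module_generated :: "('v, 'f::field) free_na set \<Rightarrow> ('v, 'f) free_na set" where
  "perm_module_generated G = perm_submodule hull G"


section \<open>Dendriform algebras\<close>

locale dendriform_algebra = vector_space scale
  for scale :: "'f::field \<Rightarrow> 'a::ab_group_add \<Rightarrow> 'a" +
  fixes succ prec :: "'a \<Rightarrow> 'a \<Rightarrow> 'a"
  assumes succ_linear_left: "Vector_Spaces.linear scale scale (\<lambda>x. succ x y)"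
    and succ_linear_right: "Vector_Spaces.linear scale scale (succ x)"
    and prec_linear_left: "Vector_Spaces.linear scale scale (\<lambda>x. prec x y)"
    and prec_linear_right: "Vector_Spaces.linear scale scale (prec x)"
    and dend1: "prec (prec x y) z = prec x (prec y z) + prec x (succ y z)"
    and dend2: "prec (succ x y) z = succ x (prec y z)"
    and dend3: "succ x (succ y z) = succ (prec x y) z + succ (succ x y) z"

text \<open>The free dendriform algebra is the free algebra with two binary operations, modulo the ideal
  generated by the dendriform relations.\<close>

datatype 'v dterm = DVar 'v | DSucc "'v dterm" "'v dterm" | DPrec "'v dterm" "'v dterm"

primrec dterm_vars :: "'v dterm \<Rightarrow> 'v list" where
  "dterm_vars (DVar v) = [v]"
| "dterm_vars (DSucc s t) = dterm_vars s @ dterm_vars t"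
| "dterm_vars (DPrec s t) = dterm_vars s @ dterm_vars t"

primrec dterm_eval ::
  "('a \<Rightarrow> 'a \<Rightarrow> 'a) \<Rightarrow> ('a \<Rightarrow> 'a \<Rightarrow> 'a) \<Rightarrow> ('v \<Rightarrow> 'a) \<Rightarrow> 'v dterm \<Rightarrow> 'a" where
  "dterm_eval sc pr f (DVar v) = f v"
| "dterm_eval sc pr f (DSucc s t) = sc (dterm_eval sc pr f s) (dterm_eval sc pr f t)"
| "dterm_eval sc pr f (DPrec s t) = pr (dterm_eval sc pr f s) (dterm_eval sc pr f t)"

abbreviation pre_succ :: "('v dterm \<Rightarrow>\<^sub>0 'f::field) \<Rightarrow> ('v dterm \<Rightarrow>\<^sub>0 'f) \<Rightarrow> ('v dterm \<Rightarrow>\<^sub>0 'f)" where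
  "pre_succ \<equiv> bilin_ext DSucc"

abbreviation pre_prec :: "('v dterm \<Rightarrow>\<^sub>0 'f::field) \<Rightarrow> ('v dterm \<Rightarrow>\<^sub>0 'f) \<Rightarrow> ('v dterm \<Rightarrow>\<^sub>0 'f)" where
  "pre_prec \<equiv> bilin_ext DPrec"

inductive_set dend_ideal :: "('v dterm \<Rightarrow>\<^sub>0 'f::field) set" where
  rel1: "pre_prec (pre_prec x y) z - (pre_prec x (pre_prec y z) + pre_prec x (pre_succ y z))
    \<in> dend_ideal"
| rel2: "pre_prec (pre_succ x y) z - pre_succ x (pre_prec y z) \<in> dend_ideal"
| rel3: "pre_succ x (pre_succ y z) - (pre_succ (pre_prec x y) z + pre_succ (pre_succ x y) z)
    \<in> dend_ideal"
| zero: "0 \<in> dend_ideal"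
| add: "p \<in> dend_ideal \<Longrightarrow> q \<in> dend_ideal \<Longrightarrow> p + q \<in> dend_ideal"
| scale: "p \<in> dend_ideal \<Longrightarrow> fv_scale c p \<in> dend_ideal"
| succ_left: "p \<in> dend_ideal \<Longrightarrow> pre_succ p q \<in> dend_ideal"
| succ_right: "p \<in> dend_ideal \<Longrightarrow> pre_succ q p \<in> dend_ideal"
| prec_left: "p \<in> dend_ideal \<Longrightarrow> pre_prec p q \<in> dend_ideal"
| prec_right: "p \<in> dend_ideal \<Longrightarrow> pre_prec q p \<in> dend_ideal"

definition dend_eq :: "('v dterm \<Rightarrow>\<^sub>0 'f::field) \<Rightarrow> ('v dterm \<Rightarrow>\<^sub>0 'f) \<Rightarrow> bool" where
  "dend_eq p q \<longleftrightarrow> p - q \<in> dend_ideal"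

lemma subspace_dend_ideal: "FV.subspace dend_ideal"
  by (simp add: FV.subspace_def dend_ideal.zero dend_ideal.add dend_ideal.scale)

lemma equivp_dend_eq: "equivp (dend_eq :: ('v dterm \<Rightarrow>\<^sub>0 'f::field) \<Rightarrow> _)"
proof (rule equivpI)
  show "reflp (dend_eq :: ('v dterm \<Rightarrow>\<^sub>0 'f) \<Rightarrow> _)"
    by (simp add: reflp_def dend_eq_def dend_ideal.zero)
  show "symp (dend_eq :: ('v dterm \<Rightarrow>\<^sub>0 'f) \<Rightarrow> _)"
  proof (rule sympI)
    fix p q :: "'v dterm \<Rightarrow>\<^sub>0 'f" assume "dend_eq p q"
    then show "dend_eq q p"
      using FV.subspace_neg[OF subspace_dend_ideal, of "p - q"] by (simp add: dend_eq_def)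
  qed
  show "transp (dend_eq :: ('v dterm \<Rightarrow>\<^sub>0 'f) \<Rightarrow> _)"
  proof (rule transpI)
    fix p q r :: "'v dterm \<Rightarrow>\<^sub>0 'f" assume "dend_eq p q" "dend_eq q r"
    then show "dend_eq p r"
      using dend_ideal.add[of "p - q" "q - r"] by (simp add: dend_eq_def)
  qed
qed

quotient_type (overloaded) ('v, 'f) free_dend = "'v dterm \<Rightarrow>\<^sub>0 'f::field" / dend_eq
  by (rule equivp_dend_eq)

lemma dend_eq_bilin:
  fixes p p' q q' :: "'v dterm \<Rightarrow>\<^sub>0 'f::field"
  assumes ideal: "\<And>p q :: 'v dterm \<Rightarrow>\<^sub>0 'f. p \<in> dend_ideal \<Longrightarrow> bilin_ext b p q \<in> dend_ideal"
      "\<And>p q :: 'v dterm \<Rightarrow>\<^sub>0 'f. p \<in> dend_ideal \<Longrightarrow> bilin_ext b q p \<in> dend_ideal"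
    and eq: "dend_eq p p'" "dend_eq q q'"
  shows "dend_eq (bilin_ext b p q) (bilin_ext b p' q')"
proof -
  have "bilin_ext b p q - bilin_ext b p' q' = bilin_ext b (p - p') q + bilin_ext b p' (q - q')"
    using module_hom.diff[OF linear_bilin_ext_left[of b q, unfolded linear_iff_module_hom], of p p']
      module_hom.diff[OF linear_bilin_ext_right[of b p', unfolded linear_iff_module_hom], of q q']
    by simp
  moreover have "bilin_ext b (p - p') q \<in> dend_ideal" "bilin_ext b p' (q - q') \<in> dend_ideal"
    using eq by (simp_all add: ideal dend_eq_def)
  ultimately show ?thesis
    by (simp add: dend_ideal.add dend_eq_def)
qed

instantiation free_dend :: (type, field) ab_group_add
begin

lift_definition zero_free_dend :: "('a, 'b) free_dend" is 0 .

lift_definition plus_free_dend :: "('a, 'b) free_dend \<Rightarrow> ('a, 'b) free_dend \<Rightarrow> ('a, 'b) free_dend"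
  is "(+)"
proof -
  fix p p' q q' :: "'a dterm \<Rightarrow>\<^sub>0 'b"
  assume "dend_eq p p'" "dend_eq q q'"
  then show "dend_eq (p + q) (p' + q')"
    using dend_ideal.add[of "p - p'" "q - q'"] by (simp add: dend_eq_def algebra_simps)
qed

lift_definition uminus_free_dend :: "('a, 'b) free_dend \<Rightarrow> ('a, 'b) free_dend" is uminus
proof -
  fix p p' :: "'a dterm \<Rightarrow>\<^sub>0 'b"
  assume "dend_eq p p'"
  then show "dend_eq (- p) (- p')"
    using FV.subspace_neg[OF subspace_dend_ideal, of "p - p'"] by (simp add: dend_eq_def)
qed

lift_definition minus_free_dend :: "('a, 'b) free_dend \<Rightarrow> ('a, 'b) free_dend \<Rightarrow> ('a, 'b) free_dend"
  is "(-)"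
proof -
  fix p p' q q' :: "'a dterm \<Rightarrow>\<^sub>0 'b"
  assume "dend_eq p p'" "dend_eq q q'"
  moreover have "p - q - (p' - q') = (p - p') - (q - q')" by simp
  ultimately show "dend_eq (p - q) (p' - q')"
    using FV.subspace_diff[OF subspace_dend_ideal] by (simp only: dend_eq_def)
qed

instance
  by standard (transfer, simp add: dend_eq_def dend_ideal.zero algebra_simps)+

end

lift_definition fd_scale :: "'f::field \<Rightarrow> ('v, 'f) free_dend \<Rightarrow> ('v, 'f) free_dend" is fv_scale
  by (simp add: dend_eq_def dend_ideal.scale flip: FV.scale_right_diff_distrib)

lift_definition fd_succ ::
  "('v, 'f::field) free_dend \<Rightarrow> ('v, 'f) free_dend \<Rightarrow> ('v, 'f) free_dend" (infixl \<open>\<succ>\<close> 70)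
  is pre_succ
  by (intro dend_eq_bilin dend_ideal.succ_left dend_ideal.succ_right)

lift_definition fd_prec ::
  "('v, 'f::field) free_dend \<Rightarrow> ('v, 'f) free_dend \<Rightarrow> ('v, 'f) free_dend" (infixl \<open>\<prec>\<close> 70)
  is pre_prec
  by (intro dend_eq_bilin dend_ideal.prec_left dend_ideal.prec_right)

lift_definition fd_var :: "'v \<Rightarrow> ('v, 'f::field) free_dend"
  is "\<lambda>v. Poly_Mapping.single (DVar v) 1" .

lemma dend_eq_refl: "p = q \<Longrightarrow> dend_eq p q"
  by (simp add: dend_eq_def dend_ideal.zero)

lemma vector_space_fd: "vector_space fd_scale"
  by (unfold_locales; transfer) (auto intro!: dend_eq_refl simp: algebra_simps)

global_interpretation FD: dendriform_algebra fd_scale fd_succ fd_prec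
proof (intro dendriform_algebra.intro dendriform_algebra_axioms.intro vector_space_fd)
  note L = linear_bilin_ext_left[unfolded linear_iff]
  note R = linear_bilin_ext_right[unfolded linear_iff]
  fix x y z :: "('b, 'a::field) free_dend"
  show "Vector_Spaces.linear fd_scale fd_scale (\<lambda>x. x \<succ> y)"
    unfolding linear_iff
    by (intro conjI vector_space_fd allI; transfer; rule dend_eq_refl) (use L in blast)+
  show "Vector_Spaces.linear fd_scale fd_scale ((\<succ>) x)"
    unfolding linear_iff
    by (intro conjI vector_space_fd allI; transfer; rule dend_eq_refl) (use R in blast)+
  show "Vector_Spaces.linear fd_scale fd_scale (\<lambda>x. x \<prec> y)"
    unfolding linear_iff
    by (intro conjI vector_space_fd allI; transfer; rule dend_eq_refl) (use L in blast)+
  show "Vector_Spaces.linear fd_scale fd_scale ((\<prec>) x)"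
    unfolding linear_iff
    by (intro conjI vector_space_fd allI; transfer; rule dend_eq_refl) (use R in blast)+
  show "(x \<prec> y) \<prec> z = x \<prec> (y \<prec> z) + x \<prec> (y \<succ> z)"
    by transfer (simp only: dend_eq_def dend_ideal.rel1)
  show "(x \<succ> y) \<prec> z = x \<succ> (y \<prec> z)"
    by transfer (simp only: dend_eq_def dend_ideal.rel2)
  show "x \<succ> (y \<succ> z) = (x \<prec> y) \<succ> z + (x \<succ> y) \<succ> z"
    by transfer (simp only: dend_eq_def dend_ideal.rel3)
qed

text \<open>The space \<open>B\<^sub>n\<close>, with \<open>n\<close> the cardinality of \<open>'v\<close>.\<close>

definition fd_multilinear :: "('v, 'f::field) free_dend set" where
  "fd_multilinear = FD.span (dterm_eval (\<succ>) (\<prec>) fd_var `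
    {t. distinct (dterm_vars t) \<and> set (dterm_vars t) = UNIV})"


section \<open>The expansion map\<close>

definition prejordan :: "('v, 'f::field) free_dend \<Rightarrow> ('v, 'f) free_dend \<Rightarrow> ('v, 'f) free_dend" where
  "prejordan x y = x \<succ> y + y \<prec> x"

text \<open>The map is defined on the whole free algebra; \<open>\<E>\<^sub>n\<close> is its restriction to \<open>A\<^sub>n\<close>.\<close>

definition expansion :: "('v, 'f::field) free_na \<Rightarrow> ('v, 'f) free_dend" where
  "expansion = lin_ext fd_scale (magma_eval prejordan fd_var)"

definition expansion_kernel :: "('v, 'f::field) free_na set" where
  "expansion_kernel = {p \<in> na_multilinear. expansion p = 0}"


section \<open>The pre-Jordan identities\<close>

definition na_circ :: "('v, 'f::field) free_na \<Rightarrow> ('v, 'f) free_na \<Rightarrow> ('v, 'f) free_na"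
    (infixl \<open>\<odot>\<close> 70) where
  "x \<odot> y = x \<cdot> y + y \<cdot> x"

definition PJ1 ::
  "('v, 'f::field) free_na \<Rightarrow> ('v, 'f) free_na \<Rightarrow> ('v, 'f) free_na \<Rightarrow> ('v, 'f) free_na \<Rightarrow>
   ('v, 'f) free_na" where
  "PJ1 x y z u =
    (x \<odot> y) \<cdot> (z \<cdot> u) + (y \<odot> z) \<cdot> (x \<cdot> u) + (z \<odot> x) \<cdot> (y \<cdot> u)
    - z \<cdot> ((x \<odot> y) \<cdot> u) - x \<cdot> ((y \<odot> z) \<cdot> u) - y \<cdot> ((z \<odot> x) \<cdot> u)"

definition PJ2 ::
  "('v, 'f::field) free_na \<Rightarrow> ('v, 'f) free_na \<Rightarrow> ('v, 'f) free_na \<Rightarrow> ('v, 'f) free_na \<Rightarrow>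
   ('v, 'f) free_na" where
  "PJ2 x y z u =
    x \<cdot> (y \<cdot> (z \<cdot> u)) + z \<cdot> (y \<cdot> (x \<cdot> u)) + ((x \<odot> z) \<odot> y) \<cdot> u
    - z \<cdot> ((x \<odot> y) \<cdot> u) - x \<cdot> ((y \<odot> z) \<cdot> u) - y \<cdot> ((z \<odot> x) \<cdot> u)"


section \<open>Consistency of the definitions\<close>

lemma linear_expansion: "Vector_Spaces.linear fv_scale fd_scale expansion"
  unfolding expansion_def by (rule linear_lin_ext[OF vector_space_fd])

lemma expansion_na_var: "expansion (na_var v) = fd_var v"
  by (simp add: expansion_def na_var_def vector_space_fd)

lemma bilinear_eqI:
  fixes g h :: "('k \<Rightarrow>\<^sub>0 'f::field) \<Rightarrow> ('k \<Rightarrow>\<^sub>0 'f) \<Rightarrow> 'a::ab_group_add"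
  assumes "\<And>q. Vector_Spaces.linear fv_scale scale (\<lambda>p. g p q)"
    and "\<And>p. Vector_Spaces.linear fv_scale scale (g p)"
    and "\<And>q. Vector_Spaces.linear fv_scale scale (\<lambda>p. h p q)"
    and "\<And>p. Vector_Spaces.linear fv_scale scale (h p)"
    and basis: "\<And>s t. g (Poly_Mapping.single s 1) (Poly_Mapping.single t 1) =
      h (Poly_Mapping.single s 1) (Poly_Mapping.single t 1)"
  shows "g p q = h p q"
proof -
  have "g (Poly_Mapping.single s 1) q = h (Poly_Mapping.single s 1) q" for s
    by (subst (1 2) linear_eq_lin_ext[where scale = scale and p = q]) (simp_all add: assms)
  then show ?thesis
    using linear_eq_lin_ext[of scale "\<lambda>p. g p q" p, OF assms(1)]
      linear_eq_lin_ext[of scale "\<lambda>p. h p q" p, OF assms(3)] by simp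
qed

lemma linear_compose2:
  assumes "Vector_Spaces.linear s1 s2 f" "Vector_Spaces.linear s2 s3 g"
  shows "Vector_Spaces.linear s1 s3 (\<lambda>x. g (f x))"
  using assms unfolding linear_iff by simp

lemma linear_add2:
  assumes "Vector_Spaces.linear s1 s2 f" "Vector_Spaces.linear s1 s2 g"
  shows "Vector_Spaces.linear s1 s2 (\<lambda>x. f x + g x)"
proof -
  interpret f: Vector_Spaces.linear s1 s2 f by fact
  show ?thesis
    using assms unfolding linear_iff by (simp add: f.vs2.scale_right_distrib algebra_simps)
qed

lemma expansion_na_mult: "expansion (p \<cdot> q) = prejordan (expansion p) (expansion q)"
proof (rule bilinear_eqI[where scale = fd_scale])
  note FD_lin = FD.succ_linear_left FD.succ_linear_right FD.prec_linear_left FD.prec_linear_right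
  note E = linear_expansion
  fix p q :: "('a, 'b) free_na"
  show "Vector_Spaces.linear fv_scale fd_scale (\<lambda>p. expansion (p \<cdot> q))"
    unfolding na_mult_def by (intro linear_compose2[OF _ E] linear_bilin_ext_left)
  show "Vector_Spaces.linear fv_scale fd_scale (\<lambda>q. expansion (p \<cdot> q))"
    unfolding na_mult_def by (intro linear_compose2[OF _ E] linear_bilin_ext_right)
  show "Vector_Spaces.linear fv_scale fd_scale (\<lambda>p. prejordan (expansion p) (expansion q))"
    unfolding prejordan_def by (intro linear_add2 linear_compose2[OF E] FD_lin)
  show "Vector_Spaces.linear fv_scale fd_scale (\<lambda>q. prejordan (expansion p) (expansion q))"
    unfolding prejordan_def by (intro linear_add2 linear_compose2[OF E] FD_lin)
qed (simp add: na_mult_def expansion_def vector_space_fd)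

lemma magma_eval_prejordan_span:
  "magma_eval prejordan fd_var t \<in> (FD.span :: ('v, 'f::field) free_dend set \<Rightarrow> _) (dterm_eval (\<succ>) (\<prec>) fd_var `
    {d. mset (dterm_vars d) = mset (magma_vars t)})"
proof (induction t)
  case (Var v)
  have "dterm_eval (\<succ>) (\<prec>) fd_var (DVar v) \<in> FD.span (dterm_eval (\<succ>) (\<prec>) fd_var `
      {d. mset (dterm_vars d) = mset (magma_vars (Var v))})"
    by (intro FD.span_base imageI) simp
  then show ?case by simp
next
  case (Mul s t)
  let ?ev = "dterm_eval (\<succ>) (\<prec>) fd_var"
  let ?S = "\<lambda>t. ?ev ` {d. mset (dterm_vars d) = mset (magma_vars t)}"
  have "a \<succ> b \<in> FD.span (?S (Mul s t)) \<and> b \<prec> a \<in> FD.span (?S (Mul s t))"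
    if a: "a \<in> FD.span (?S s)" and b: "b \<in> FD.span (?S t)" for a b :: "('v, 'f) free_dend"
  proof -
    have base: "?ev c \<succ> ?ev d \<in> FD.span (?S (Mul s t)) \<and> ?ev d \<prec> ?ev c \<in> FD.span (?S (Mul s t))"
      if "mset (dterm_vars c) = mset (magma_vars s)" "mset (dterm_vars d) = mset (magma_vars t)"
      for c d
    proof -
      have "?ev (DSucc c d) \<in> FD.span (?S (Mul s t))" "?ev (DPrec d c) \<in> FD.span (?S (Mul s t))"
        using that by (intro FD.span_base imageI; simp)+
      then show ?thesis by simp
    qed
    have lin: "(p + q) \<succ> x = p \<succ> x + q \<succ> x" "fd_scale k p \<succ> x = fd_scale k (p \<succ> x)"
      "x \<succ> (p + q) = x \<succ> p + x \<succ> q" "x \<succ> fd_scale k p = fd_scale k (x \<succ> p)"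
      "(p + q) \<prec> x = p \<prec> x + q \<prec> x" "fd_scale k p \<prec> x = fd_scale k (p \<prec> x)"
      "x \<prec> (p + q) = x \<prec> p + x \<prec> q" "x \<prec> fd_scale k p = fd_scale k (x \<prec> p)"
      for k and p q x :: "('v, 'f) free_dend"
      using FD.succ_linear_left FD.succ_linear_right FD.prec_linear_left FD.prec_linear_right
      unfolding linear_iff by blast+
    have z: "x \<succ> 0 = 0" "0 \<succ> x = 0" "x \<prec> 0 = 0" "0 \<prec> x = 0" for x :: "('v, 'f) free_dend"
      using FD.succ_linear_left FD.succ_linear_right FD.prec_linear_left FD.prec_linear_right
        module_hom.zero linear_iff_module_hom by metis+
    have right: "?ev c \<succ> b \<in> FD.span (?S (Mul s t)) \<and> b \<prec> ?ev c \<in> FD.span (?S (Mul s t))"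
      if "mset (dterm_vars c) = mset (magma_vars s)" for c
      using b
      by (induction rule: FD.span_induct_alt)
         (use base[OF that] in \<open>auto simp: z lin intro!: FD.span_add FD.span_scale FD.span_zero\<close>)
    show ?thesis
      using a
      by (induction rule: FD.span_induct_alt)
         (use right in \<open>auto simp: z lin intro!: FD.span_add FD.span_scale FD.span_zero\<close>)
  qed
  then show ?case
    using Mul by (simp add: prejordan_def FD.span_add)
qed

lemma expansion_multilinear:
  assumes "p \<in> na_multilinear"
  shows "expansion p \<in> fd_multilinear"
  unfolding expansion_def lin_ext_def fd_multilinear_def
proof (intro FD.span_sum FD.span_scale)
  fix t assume "t \<in> Poly_Mapping.keys p"
  then have "distinct (magma_vars t)" "set (magma_vars t) = UNIV"
    using assms by (auto simp: na_multilinear_def)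
  then have "{d. mset (dterm_vars d) = mset (magma_vars t)} \<subseteq>
      {d. distinct (dterm_vars d) \<and> set (dterm_vars d) = UNIV}"
    by (metis (mono_tags, lifting) Collect_mono mset_eq_imp_distinct_iff mset_eq_setD)
  then show "magma_eval prejordan fd_var t \<in> FD.span (dterm_eval (\<succ>) (\<prec>) fd_var `
      {t. distinct (dterm_vars t) \<and> set (dterm_vars t) = UNIV})"
    using magma_eval_prejordan_span[of t] FD.span_mono[OF image_mono] by blast
qed

text \<open>The quotient has the universal property of the free dendriform algebra.\<close>

lemma free_dend_abs_cases:
  obtains p where "x = abs_free_dend p"
  using Quotient3_abs_rep[OF Quotient3_free_dend] by metis

lemma free_dend_induct:
  assumes "P 0" "\<And>v. P (fd_var v)" "\<And>p q. P p \<Longrightarrow> P q \<Longrightarrow> P (p + q)" "\<And>c p. P p \<Longrightarrow> P (fd_scale c p)"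
    "\<And>p q. P p \<Longrightarrow> P q \<Longrightarrow> P (p \<succ> q)" "\<And>p q. P p \<Longrightarrow> P q \<Longrightarrow> P (p \<prec> q)"
  shows "P (x :: ('v, 'f::field) free_dend)"
proof -
  have mono: "P (abs_free_dend (Poly_Mapping.single t 1))" for t
  proof (induction t)
    case (DVar v)
    then show ?case using assms(2)[of v] by (simp add: fd_var.abs_eq)
  next
    case (DSucc s t)
    then show ?case using assms(5) by (fastforce simp: fd_succ.abs_eq)
  next
    case (DPrec s t)
    then show ?case using assms(6) by (fastforce simp: fd_prec.abs_eq)
  qed
  have sum: "P (abs_free_dend (\<Sum>k\<in>K. fv_scale (c k) (Poly_Mapping.single k 1)))"
    if "finite K" for K and c :: "_ \<Rightarrow> 'f"
    using that
  proof (induction K rule: finite_induct)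
    case empty
    then show ?case using assms(1) by (simp add: zero_free_dend.abs_eq)
  next
    case (insert k K)
    have "P (abs_free_dend (fv_scale (c k) (Poly_Mapping.single k 1)))"
      using assms(4)[OF mono, of "c k" k] by (simp only: fd_scale.abs_eq)
    from assms(3)[OF this insert.IH] show ?case
      by (simp only: plus_free_dend.abs_eq sum.insert[OF insert.hyps])
  qed
  obtain p where "x = abs_free_dend p" by (rule free_dend_abs_cases)
  moreover have "P (abs_free_dend p)"
    using sum[of "Poly_Mapping.keys p" "Poly_Mapping.lookup p"] fv_expansion[of p]
    by (simp add: lin_ext_def)
  ultimately show ?thesis by simp
qed

lemma (in dendriform_algebra) free_dend_universal:
  "\<exists>!h. Vector_Spaces.linear fd_scale scale h \<and> (\<forall>v. h (fd_var v) = f v) \<and>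
    (\<forall>p q. h (p \<succ> q) = succ (h p) (h q)) \<and> (\<forall>p q. h (p \<prec> q) = prec (h p) (h q))"
proof (rule ex_ex1I)
  have V: "vector_space scale" by unfold_locales
  define g where "g = lin_ext scale (dterm_eval succ prec f)"
  have lin: "Vector_Spaces.linear fv_scale scale g"
    unfolding g_def by (rule linear_lin_ext[OF V])
  interpret g: Vector_Spaces.linear fv_scale scale g by (rule lin)
  have s: "g (pre_succ p q) = succ (g p) (g q)" for p q
  proof (rule bilinear_eqI[where scale = scale])
    fix p q
    show "Vector_Spaces.linear fv_scale scale (\<lambda>p. g (pre_succ p q))"
      by (intro linear_compose2[OF _ lin] linear_bilin_ext_left)
    show "Vector_Spaces.linear fv_scale scale (\<lambda>q. g (pre_succ p q))"
      by (intro linear_compose2[OF _ lin] linear_bilin_ext_right)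
    show "Vector_Spaces.linear fv_scale scale (\<lambda>p. succ (g p) (g q))"
      by (intro linear_compose2[OF lin] succ_linear_left)
    show "Vector_Spaces.linear fv_scale scale (\<lambda>q. succ (g p) (g q))"
      by (intro linear_compose2[OF lin] succ_linear_right)
  qed (simp add: g_def V)
  have p: "g (pre_prec p q) = prec (g p) (g q)" for p q
  proof (rule bilinear_eqI[where scale = scale])
    fix p q
    show "Vector_Spaces.linear fv_scale scale (\<lambda>p. g (pre_prec p q))"
      by (intro linear_compose2[OF _ lin] linear_bilin_ext_left)
    show "Vector_Spaces.linear fv_scale scale (\<lambda>q. g (pre_prec p q))"
      by (intro linear_compose2[OF _ lin] linear_bilin_ext_right)
    show "Vector_Spaces.linear fv_scale scale (\<lambda>p. prec (g p) (g q))"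
      by (intro linear_compose2[OF lin] prec_linear_left)
    show "Vector_Spaces.linear fv_scale scale (\<lambda>q. prec (g p) (g q))"
      by (intro linear_compose2[OF lin] prec_linear_right)
  qed (simp add: g_def V)
  have z: "succ x 0 = 0" "succ 0 x = 0" "prec x 0 = 0" "prec 0 x = 0" for x
    using succ_linear_left succ_linear_right prec_linear_left prec_linear_right
      module_hom.zero linear_iff_module_hom by metis+
  have ker: "g p = 0" if "p \<in> dend_ideal" for p
    using that
    by induction (simp_all add: g.add g.diff g.scale s p dend1 dend2 dend3 z)
  define h where "h x = g (rep_free_dend x)" for x
  have h: "h (abs_free_dend p) = g p" for p
  proof -
    have "dend_eq (rep_free_dend (abs_free_dend p)) p"
      using Quotient3_rep_abs[OF Quotient3_free_dend dend_eq_refl[OF refl]] by blast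
    then show ?thesis
      using ker unfolding h_def dend_eq_def by (metis g.diff right_minus_eq)
  qed
  have "h (x + y) = h x + h y" for x y
    by (cases x rule: free_dend_abs_cases; cases y rule: free_dend_abs_cases) (simp add: plus_free_dend.abs_eq h g.add)
  moreover have "h (fd_scale c x) = scale c (h x)" for c x
    by (cases x rule: free_dend_abs_cases) (simp add: fd_scale.abs_eq h g.scale)
  moreover have "h (x \<succ> y) = succ (h x) (h y)" for x y
    by (cases x rule: free_dend_abs_cases; cases y rule: free_dend_abs_cases) (simp add: fd_succ.abs_eq h s)
  moreover have "h (x \<prec> y) = prec (h x) (h y)" for x y
    by (cases x rule: free_dend_abs_cases; cases y rule: free_dend_abs_cases) (simp add: fd_prec.abs_eq h p)
  moreover have "h (fd_var v) = f v" for v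
    by (simp add: fd_var.abs_eq h g_def V)
  ultimately show "\<exists>h. Vector_Spaces.linear fd_scale scale h \<and> (\<forall>v. h (fd_var v) = f v) \<and>
    (\<forall>p q. h (p \<succ> q) = succ (h p) (h q)) \<and> (\<forall>p q. h (p \<prec> q) = prec (h p) (h q))"
    using V vector_space_fd unfolding linear_iff by blast
next
  fix h h'
  assume h: "Vector_Spaces.linear fd_scale scale h \<and> (\<forall>v. h (fd_var v) = f v) \<and>
    (\<forall>p q. h (p \<succ> q) = succ (h p) (h q)) \<and> (\<forall>p q. h (p \<prec> q) = prec (h p) (h q))"
  assume h': "Vector_Spaces.linear fd_scale scale h' \<and> (\<forall>v. h' (fd_var v) = f v) \<and>
    (\<forall>p q. h' (p \<succ> q) = succ (h' p) (h' q)) \<and> (\<forall>p q. h' (p \<prec> q) = prec (h' p) (h' q))"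
  have z: "h 0 = 0" "h' 0 = 0"
    using h h' module_hom.zero linear_iff_module_hom by metis+
  have "h x = h' x" for x
    by (induction x rule: free_dend_induct) (use h h' in \<open>auto simp: linear_iff z\<close>)
  then show "h = h'" by blast
qed

end

theory Submission
  imports Defs "HOL-Library.Function_Algebras"
begin

text \<open>
  In a pre-Jordan product \<open>s \<succ> t + t \<prec> s\<close> both half products let \<open>t\<close> dominate. The proof that the
  kernel is no larger than claimed exploits this through one family of test algebras. Rank the
  variables by natural numbers, and on words let \<open>v \<succ> w = v w\<close> if the maximal rank of \<open>v w\<close> occurs in \<open>w\<close>, and \<open>0\<close>
  otherwise; let \<open>v \<prec> w\<close> be \<open>v w\<close> in the complementary case. This is a dendriform algebra, since the
  position of the maximum alone decides whether a product of three words is \<open>0\<close>.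
  A multilinear monomial evaluates to \<open>0\<close> unless in each of its products the right factor has the
  larger maximum, and otherwise to the fully expanded Jordan product of its variables.

  Reading off the coefficient of a word \<open>w\<close>: a monomial contributes once for every bracketing of
  \<open>w\<close> which becomes this monomial after each product has been oriented with its larger factor on
  the right. So if \<open>p\<close> expands to \<open>0\<close>, then for each ranking and each word the sum of the
  coefficients of \<open>p\<close> at the oriented bracketings of the word is \<open>0\<close>
  (\<open>expansion_zero_bracketings\<close>).

  A word of length four has only five bracketings. Let \<open>d\<close> have the highest rank. The words
  \<open>d x y z\<close> and \<open>x d y z\<close>, for all orders of \<open>x, y, z\<close>, give a small linear system, and its solution
  shows that the coefficients at the monomials ending in \<open>d\<close> depend on four numbers only: the common
  coefficient \<open>\<kappa>\<close> of the monomials \<open>(x y) (z d)\<close>, and for each choice of the middle variable \<open>y\<close> the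
  common coefficient \<open>\<mu>\<close> of \<open>x (y (z d))\<close> and \<open>z (y (x d))\<close>. Each ranking only sees the monomials
  that it orients correctly; varying the ranking reaches all of them (\<open>kernel_relations\<close>). These are
  exactly the coefficients of a combination of \<open>\<kappa>\<close> times one \<open>PJ1\<close> and \<open>\<mu>\<close> times three \<open>PJ2\<close>, and
  averaging over the orders of \<open>x, y, z\<close> writes \<open>p\<close> in this form (\<open>kernel_as_PJ_sum\<close>).

  The other inclusion needs only that both identities expand to \<open>0\<close>, which the dendriform laws
  give by rewriting to normal form, and that the kernel is stable under permutations of the variables,
  which holds because a permutation extends to an endomorphism of the free dendriform algebra.
\<close>

section \<open>A dendriform algebra of ranked words\<close>

primrec top_rank :: "('v \<Rightarrow> nat) \<Rightarrow> 'v list \<Rightarrow> nat" where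
  "top_rank r [] = 0"
| "top_rank r (v # w) = max (r v) (top_rank r w)"

lemma top_rank_append [simp]: "top_rank r (v @ w) = max (top_rank r v) (top_rank r w)"
  by (induction v) auto

definition splits :: "'v list \<Rightarrow> ('v list \<times> 'v list) set" where
  "splits w = {(x, y). x @ y = w}"

lemma splits_eq_image: "splits w = (\<lambda>i. (take i w, drop i w)) ` {..length w}"
proof (intro set_eqI iffI)
  fix z assume "z \<in> splits w"
  then have "z = (take (length (fst z)) w, drop (length (fst z)) w)" "length (fst z) \<le> length w"
    by (auto simp: splits_def)
  then show "z \<in> (\<lambda>i. (take i w, drop i w)) ` {..length w}" by blast
qed (auto simp: splits_def)

lemma finite_splits [simp]: "finite (splits w)"
  by (simp add: splits_eq_image)

lemma sum_splits:
  "(\<Sum>(x, y)\<in>splits w. g x y) = (\<Sum>i\<le>length w. g (take i w) (drop i w))"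
proof -
  have "inj_on (\<lambda>i. (take i w, drop i w)) {..length w}"
    by (auto simp: inj_on_def dest: arg_cong[where f = length])
  then show ?thesis
    by (simp add: splits_eq_image sum.reindex)
qed

definition splits3 :: "'v list \<Rightarrow> ('v list \<times> 'v list \<times> 'v list) set" where
  "splits3 w = {(x, y, z). x @ y @ z = w}"

lemma sum_splits_left:
  "(\<Sum>(v, z)\<in>splits w. \<Sum>(x, y)\<in>splits v. g x y z) = (\<Sum>(x, y, z)\<in>splits3 w. g x y z)"
proof -
  have "(\<Sum>(v, z)\<in>splits w. \<Sum>(x, y)\<in>splits v. g x y z) =
      (\<Sum>((v, z), x, y)\<in>Sigma (splits w) (\<lambda>(v, z). splits v). g x y z)"
    by (simp add: sum.Sigma case_prod_unfold)
  also have "\<dots> = (\<Sum>(x, y, z)\<in>splits3 w. g x y z)"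
    by (rule sum.reindex_bij_witness[where i = "\<lambda>(x, y, z). ((x @ y, z), x, y)"
          and j = "\<lambda>((v, z), x, y). (x, y, z)"])
       (auto simp: splits_def splits3_def)
  finally show ?thesis .
qed

lemma sum_splits_right:
  "(\<Sum>(x, v)\<in>splits w. \<Sum>(y, z)\<in>splits v. g x y z) = (\<Sum>(x, y, z)\<in>splits3 w. g x y z)"
proof -
  have "(\<Sum>(x, v)\<in>splits w. \<Sum>(y, z)\<in>splits v. g x y z) =
      (\<Sum>((x, v), y, z)\<in>Sigma (splits w) (\<lambda>(x, v). splits v). g x y z)"
    by (simp add: sum.Sigma case_prod_unfold)
  also have "\<dots> = (\<Sum>(x, y, z)\<in>splits3 w. g x y z)"
    by (rule sum.reindex_bij_witness[where i = "\<lambda>(x, y, z). ((x, y @ z), y, z)"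
          and j = "\<lambda>((x, v), y, z). (x, y, z)"])
       (auto simp: splits_def splits3_def)
  finally show ?thesis .
qed

text \<open>Elements are functions from words to scalars, so that \<open>p w\<close> is the coefficient of \<open>w\<close> in a possibly
  infinite combination \<open>p\<close>. Concatenation becomes convolution over the splittings of a word, here
  restricted to the splittings that satisfy \<open>C\<close>.\<close>

definition word_conv ::
  "('v list \<Rightarrow> 'v list \<Rightarrow> bool) \<Rightarrow> ('v list \<Rightarrow> 'f::field) \<Rightarrow> ('v list \<Rightarrow> 'f) \<Rightarrow> 'v list \<Rightarrow> 'f" where
  "word_conv C p q w = (\<Sum>(x, y)\<in>splits w. of_bool (C x y) * (p x * q y))"

definition word_scale :: "'f::field \<Rightarrow> ('v list \<Rightarrow> 'f) \<Rightarrow> 'v list \<Rightarrow> 'f" where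
  "word_scale c p w = c * p w"

definition word_succ where
  "word_succ r = word_conv (\<lambda>x y. top_rank r x \<le> top_rank r y)"

definition word_prec where
  "word_prec r = word_conv (\<lambda>x y. top_rank r x > top_rank r y)"

lemma word_conv_left:
  "word_conv C (word_conv D p q) s w =
    (\<Sum>(x, y, z)\<in>splits3 w. of_bool (D x y \<and> C (x @ y) z) * (p x * q y * s z))"
proof -
  have "word_conv C (word_conv D p q) s w =
      (\<Sum>(v, z)\<in>splits w. \<Sum>(x, y)\<in>splits v. of_bool (D x y \<and> C (x @ y) z) * (p x * q y * s z))"
    unfolding word_conv_def
    by (auto simp: sum_distrib_left sum_distrib_right splits_def intro!: sum.cong)
  then show ?thesis by (simp add: sum_splits_left)
qed

lemma word_conv_right:
  "word_conv C p (word_conv D q s) w =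
    (\<Sum>(x, y, z)\<in>splits3 w. of_bool (D y z \<and> C x (y @ z)) * (p x * q y * s z))"
proof -
  have "word_conv C p (word_conv D q s) w =
      (\<Sum>(x, v)\<in>splits w. \<Sum>(y, z)\<in>splits v. of_bool (D y z \<and> C x (y @ z)) * (p x * q y * s z))"
    unfolding word_conv_def
    by (auto simp: sum_distrib_left sum_distrib_right splits_def intro!: sum.cong)
  then show ?thesis by (simp add: sum_splits_right)
qed

lemma vector_space_word: "vector_space word_scale"
  by unfold_locales (auto simp: word_scale_def fun_eq_iff algebra_simps)

lemma linear_word_conv:
  "Vector_Spaces.linear word_scale word_scale (\<lambda>p. word_conv C p q)"
  "Vector_Spaces.linear word_scale word_scale (word_conv C p)"
  unfolding linear_iff
  by (auto simp: vector_space_word fun_eq_iff word_conv_def word_scale_def case_prod_unfold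
      algebra_simps sum.distrib sum_distrib_left)

text \<open>After both sides of each law are written as sums over splittings into three parts \<open>x, y, z\<close>, only
  conditions on maxima remain: for the second law they say that the maximum is attained in \<open>y\<close>, for
  the third that it is attained in \<open>z\<close>, and for the first that it is attained in \<open>x\<close> alone, ties
  being resolved in favour of the right factor.\<close>

lemma dendriform_words: "dendriform_algebra word_scale (word_succ r) (word_prec r)"
proof (intro dendriform_algebra.intro dendriform_algebra_axioms.intro vector_space_word)
  fix p q s :: "'b list \<Rightarrow> 'a"
  show "word_prec r (word_prec r p q) s = word_prec r p (word_prec r q s) + word_prec r p (word_succ r q s)"
    by (auto simp: fun_eq_iff word_succ_def word_prec_def word_conv_left word_conv_right
        simp flip: sum.distrib intro!: sum.cong)
  show "word_prec r (word_succ r p q) s = word_succ r p (word_prec r q s)"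
    by (auto simp: fun_eq_iff word_succ_def word_prec_def word_conv_left word_conv_right intro!: sum.cong)
  show "word_succ r p (word_succ r q s) = word_succ r (word_prec r p q) s + word_succ r (word_succ r p q) s"
    by (auto simp: fun_eq_iff word_succ_def word_prec_def word_conv_left word_conv_right
        simp flip: sum.distrib intro!: sum.cong)
qed (simp_all add: word_succ_def word_prec_def linear_word_conv)

section \<open>Coefficients of an element of the kernel along a word\<close>

text \<open>If a word is split into a part read from \<open>s\<close> and then a part read from \<open>t\<close>, this splitting
  contributes to the value of only one of the products \<open>Mul s t\<close> and \<open>Mul t s\<close>, namely this one.\<close>

definition orient :: "('v \<Rightarrow> nat) \<Rightarrow> 'v magma \<Rightarrow> 'v magma \<Rightarrow> 'v magma" where
  "orient r s t =
    (if top_rank r (magma_vars s) \<le> top_rank r (magma_vars t) then Mul s t else Mul t s)"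

text \<open>The list has one entry for every bracketing of the word. Repetitions count: for words with repeated
  letters, two bracketings can give the same tree.\<close>

function bracketings :: "('v \<Rightarrow> nat) \<Rightarrow> 'v list \<Rightarrow> 'v magma list" where
  "bracketings r [] = []"
| "bracketings r [v] = [Var v]"
| "bracketings r (v # v' # w) =
    concat (map (\<lambda>i. [orient r s t. s \<leftarrow> bracketings r (take i (v # v' # w)),
                                    t \<leftarrow> bracketings r (drop i (v # v' # w))])
                [1..<length (v # v' # w)])"
  by pat_completeness auto
termination by (relation "measure (length \<circ> snd)") auto

declare bracketings.simps(3) [simp del]

lemma top_rank_orient [simp]:
  "top_rank r (magma_vars (orient r s t)) = max (top_rank r (magma_vars s)) (top_rank r (magma_vars t))"
  by (simp add: orient_def max.commute)

lemma top_rank_bracketings: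
  "t \<in> set (bracketings r w) \<Longrightarrow> top_rank r (magma_vars t) = top_rank r w"
proof (induction r w arbitrary: t rule: bracketings.induct)
  case (3 r v v' w)
  let ?w = "v # v' # w"
  from "3.prems" obtain i s s' where i: "i \<in> set [1..<length ?w]"
    and s: "s \<in> set (bracketings r (take i ?w))" "s' \<in> set (bracketings r (drop i ?w))"
    and t: "t = orient r s s'"
    by (auto simp only: bracketings.simps(3) set_concat set_map)
  have "top_rank r (magma_vars t) = max (top_rank r (take i ?w)) (top_rank r (drop i ?w))"
    using "3.IH"(1)[OF i s(1)] "3.IH"(2)[OF i s(1) s(2)] by (simp add: t)
  then show ?case by (simp only: append_take_drop_id flip: top_rank_append)
qed auto

lemma count_list_Mul:
  "count_list [Mul s' t'. s' \<leftarrow> xs, t' \<leftarrow> ys] (Mul s t) = count_list xs s * count_list ys t"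
proof (induction xs)
  case (Cons x xs)
  have "count_list (map (Mul x) ys) (Mul s t) = (if x = s then count_list ys t else 0)"
    by (induction ys) auto
  with Cons show ?case by simp
qed simp

lemma count_list_Mul_swap:
  "count_list [Mul t' s'. s' \<leftarrow> xs, t' \<leftarrow> ys] (Mul s t) = count_list xs t * count_list ys s"
proof (induction xs)
  case (Cons x xs)
  have "count_list (map (\<lambda>t'. Mul t' x) ys) (Mul s t) = (if x = t then count_list ys s else 0)"
    by (induction ys) auto
  with Cons show ?case by simp
qed simp

lemma count_list_concat: "count_list (concat xss) x = (\<Sum>xs\<leftarrow>xss. count_list xs x)"
  by (induction xss) auto

lemma count_orient:
  "count_list [orient r s' t'. s' \<leftarrow> bracketings r x, t' \<leftarrow> bracketings r y] (Mul s t) =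
   (if top_rank r x \<le> top_rank r y
    then count_list (bracketings r x) s * count_list (bracketings r y) t
    else count_list (bracketings r x) t * count_list (bracketings r y) s)"
proof -
  have "[orient r s' t'. s' \<leftarrow> bracketings r x, t' \<leftarrow> bracketings r y] =
      (if top_rank r x \<le> top_rank r y
       then [Mul s' t'. s' \<leftarrow> bracketings r x, t' \<leftarrow> bracketings r y]
       else [Mul t' s'. s' \<leftarrow> bracketings r x, t' \<leftarrow> bracketings r y])"
    by (auto simp: orient_def top_rank_bracketings intro!: arg_cong[where f = concat] map_cong)
  then show ?thesis by (simp add: count_list_Mul count_list_Mul_swap)
qed

lemma count_bracketings_Mul:
  "count_list (bracketings r w) (Mul s t) =
    (\<Sum>(x, y)\<in>splits w. if top_rank r x \<le> top_rank r y
       then count_list (bracketings r x) s * count_list (bracketings r y) t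
       else count_list (bracketings r x) t * count_list (bracketings r y) s)"
    (is "_ = (\<Sum>(x, y)\<in>splits w. ?g x y)")
proof -
  have "count_list (bracketings r w) (Mul s t) = (\<Sum>i\<in>{1..<length w}. ?g (take i w) (drop i w))"
  proof (cases "(r, w)" rule: bracketings.cases)
    case (3 r' v v' w')
    then have w: "w = v # v' # w'" by simp
    show ?thesis
      unfolding w bracketings.simps(3) count_list_concat
      by (simp add: comp_def count_orient sum_list_distinct_conv_sum_set del: upt_Suc)
  qed auto
  also have "\<dots> = (\<Sum>i\<le>length w. ?g (take i w) (drop i w))"
  proof (rule sum.mono_neutral_left)
    show "\<forall>i\<in>{..length w} - {1..<length w}. ?g (take i w) (drop i w) = 0"
    proof
      fix i assume "i \<in> {..length w} - {1..<length w}"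
      then consider "i = 0" | "i = length w" by force
      then show "?g (take i w) (drop i w) = 0" by cases auto
    qed
  qed auto
  finally show ?thesis by (simp add: sum_splits)
qed

definition letter :: "'v \<Rightarrow> 'v list \<Rightarrow> 'f::field" where
  "letter v w = of_bool (w = [v])"

text \<open>By definition \<open>Mul s t\<close> evaluates to \<open>s \<succ> t + t \<prec> s\<close>, where \<open>s \<succ> t\<close> sees the splittings whose right
  part attains the maximum, and \<open>t \<prec> s\<close> the others with the roles exchanged. This is the recursion
  of \<open>count_bracketings_Mul\<close>.\<close>

lemma magma_eval_words:
  fixes w :: "'v list"
  shows "magma_eval (\<lambda>p q. word_succ r p q + word_prec r q p) letter t w =
    (of_nat (count_list (bracketings r w) t) :: 'f::field)"
proof (induction t arbitrary: w)
  case (Var v)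
  have "Var v \<notin> set (bracketings r (x # y # u))" for x y u
    by (auto simp: bracketings.simps(3) orient_def simp del: upt_Suc)
  then show ?case
    by (cases "(r, w)" rule: bracketings.cases) (auto simp: letter_def)
next
  case (Mul s t)
  define ev :: "'v magma \<Rightarrow> 'v list \<Rightarrow> 'f"
    where "ev = magma_eval (\<lambda>p q. word_succ r p q + word_prec r q p) letter"
  have ev: "ev s w = of_nat (count_list (bracketings r w) s)"
    "ev t w = of_nat (count_list (bracketings r w) t)" for w
    unfolding ev_def by (fact Mul.IH)+
  have "ev (Mul s t) w = word_succ r (ev s) (ev t) w + word_prec r (ev t) (ev s) w"
    by (simp add: ev_def)
  also have "\<dots> = of_nat (count_list (bracketings r w) (Mul s t))"
    unfolding word_succ_def word_prec_def word_conv_def count_bracketings_Mul ev of_nat_sum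
      sum.distrib[symmetric]
    by (rule sum.cong) auto
  finally show ?case by (simp only: ev_def)
qed

lemma sum_keys_count_list:
  "(\<Sum>t\<in>Poly_Mapping.keys p. Poly_Mapping.lookup p t * of_nat (count_list ts t)) =
    (\<Sum>t\<leftarrow>ts. Poly_Mapping.lookup p t :: 'f::field)"
proof (induction ts)
  case (Cons t ts)
  have "(\<Sum>s\<in>Poly_Mapping.keys p. Poly_Mapping.lookup p s * of_nat (count_list (t # ts) s)) =
      (\<Sum>s\<in>Poly_Mapping.keys p. Poly_Mapping.lookup p s * of_nat (count_list ts s)) +
      (\<Sum>s\<in>Poly_Mapping.keys p. if s = t then Poly_Mapping.lookup p s else 0)"
    unfolding sum.distrib[symmetric] by (rule sum.cong) (auto simp: algebra_simps)
  also have "(\<Sum>s\<in>Poly_Mapping.keys p. if s = t then Poly_Mapping.lookup p s else 0) = Poly_Mapping.lookup p t"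
    by (simp add: in_keys_iff)
  finally show ?case using Cons by simp
qed simp

lemma sum_apply: "(\<Sum>a\<in>A. f a) w = (\<Sum>a\<in>A. f a w :: 'f::field)"
  by (induction A rule: infinite_finite_induct) auto

text \<open>The homomorphism from the free dendriform algebra to the words, which sends each variable to its
  letter, must map \<open>0 = expansion p\<close> to \<open>0\<close>; its coefficient at \<open>w\<close> is the given sum.\<close>

lemma expansion_zero_bracketings:
  fixes p :: "('v, 'f::field) free_na"
  assumes "expansion p = 0"
  shows "(\<Sum>t\<leftarrow>bracketings r w. Poly_Mapping.lookup p t) = 0"
proof -
  interpret D: dendriform_algebra word_scale "word_succ r" "word_prec r"
    by (rule dendriform_words)
  obtain h :: "('v, 'f) free_dend \<Rightarrow> 'v list \<Rightarrow> 'f"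
    where lin: "Vector_Spaces.linear fd_scale word_scale h" and var: "\<And>v. h (fd_var v) = letter v"
      and succ: "\<And>p q. h (p \<succ> q) = word_succ r (h p) (h q)"
      and prec: "\<And>p q. h (p \<prec> q) = word_prec r (h p) (h q)"
    using D.free_dend_universal[of letter] by blast
  interpret h: Vector_Spaces.linear fd_scale word_scale h by (rule lin)
  have mono: "h (magma_eval prejordan fd_var t) =
      magma_eval (\<lambda>p q. word_succ r p q + word_prec r q p) letter t" for t
    by (induction t) (simp_all add: var prejordan_def h.add succ prec)
  have "h (expansion p) w = (\<Sum>t\<in>Poly_Mapping.keys p.
      Poly_Mapping.lookup p t * of_nat (count_list (bracketings r w) t))"
    unfolding expansion_def lin_ext_def
    by (simp add: h.sum h.scale mono word_scale_def magma_eval_words sum_apply)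
  then show ?thesis
    by (simp add: assms h.zero sum_keys_count_list)
qed

section \<open>The linear relations in degree four\<close>

lemma orient_commute:
  "top_rank r (magma_vars s) \<noteq> top_rank r (magma_vars t) \<Longrightarrow> orient r s t = orient r t s"
  by (auto simp: orient_def)

lemma orient_right:
  "top_rank r (magma_vars s) \<le> top_rank r (magma_vars t) \<Longrightarrow> orient r s t = Mul s t"
  by (simp add: orient_def)

lemma orient_left:
  "top_rank r (magma_vars t) < top_rank r (magma_vars s) \<Longrightarrow> orient r s t = Mul t s"
  by (simp add: orient_def)

lemma bracketings_four:
  "bracketings r [a, b, c, d] =
    [orient r (Var a) (orient r (Var b) (orient r (Var c) (Var d))),
     orient r (Var a) (orient r (orient r (Var b) (Var c)) (Var d)),
     orient r (orient r (Var a) (Var b)) (orient r (Var c) (Var d)),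
     orient r (orient r (Var a) (orient r (Var b) (Var c))) (Var d),
     orient r (orient r (orient r (Var a) (Var b)) (Var c)) (Var d)]"
  by (simp add: bracketings.simps(3) upt_rec)

text \<open>For a fixed ranking with \<open>d\<close> on top, each unordered pair or triple has one visible order, so \<open>Q\<close>,
  \<open>R\<close>, \<open>S\<close> below are symmetric in their last two arguments; only the first is written here. The words \<open>d x y z\<close> express the
  coefficients \<open>P\<close> by the others. Substituting this in the relations of the words \<open>x d y z\<close> gives
  \<open>2 (Q y + R z + S x + S y + S z) = 0\<close>, so that \<open>Q y + R z\<close> does not depend on \<open>y \<noteq> z\<close>; hence \<open>Q\<close> is
  constant, and everything else follows.\<close>

lemma kernel_relations_oriented:
  fixes p :: "('v, 'f::field_char_0) free_na"
  assumes p: "expansion p = 0" and r: "distinct [r x, r y, r z]"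
    and top: "r x < r d" "r y < r d" "r z < r d"
  defines "c \<equiv> Poly_Mapping.lookup p" and "pr \<equiv> \<lambda>v w. orient r (Var v) (Var w)"
  shows "c (Mul (Var x) (Mul (Var y) (Mul (Var z) (Var d)))) =
      c (Mul (orient r (Var y) (pr x z)) (Var d))"
    and "c (Mul (pr y z) (Mul (Var x) (Var d))) = c (Mul (pr x z) (Mul (Var y) (Var d)))"
    and "c (Mul (Var x) (Mul (pr y z) (Var d))) = - c (Mul (pr y z) (Mul (Var x) (Var d)))
      - c (Mul (orient r (Var x) (pr y z)) (Var d))
      - c (Mul (orient r (Var y) (pr x z)) (Var d))
      - c (Mul (orient r (Var z) (pr x y)) (Var d))"
proof -
  define D where "D x y z \<longleftrightarrow> distinct [r x, r y, r z] \<and> r x < r d \<and> r y < r d \<and> r z < r d" for x y z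
  define P where "P x y z = c (Mul (Var x) (Mul (Var y) (Mul (Var z) (Var d))))" for x y z
  define Q where "Q x y z = c (Mul (pr y z) (Mul (Var x) (Var d)))" for x y z
  define R where "R x y z = c (Mul (Var x) (Mul (pr y z) (Var d)))" for x y z
  define S where "S x y z = c (Mul (orient r (Var x) (pr y z)) (Var d))" for x y z
  have pr_sym: "pr v w = pr w v" if "r v \<noteq> r w" for v w
    using that by (simp add: pr_def orient_commute)
  have sym: "Q x y z = Q x z y" "R x y z = R x z y" "S x y z = S x z y" if "D x y z" for x y z
    using that pr_sym[of y z] by (simp_all add: D_def Q_def R_def S_def)
  have Dp: "D x z y" "D y x z" "D y z x" "D z x y" "D z y x" if "D x y z" for x y z
    using that by (auto simp: D_def)
  have A: "P z y x + Q x y z + R z x y + S x y z + S z x y = 0"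
    and B: "P x z y + P z x y + P z y x + Q x y z + R x y z = 0" if "D x y z" for x y z
  proof -
    have top: "r x < r d" "r y < r d" "r z < r d" "r x \<le> r d" "r y \<le> r d" "r z \<le> r d"
      using that by (auto simp: D_def)
    have "orient r (orient r (Var x) (Var y)) (Var z) = orient r (Var z) (orient r (Var x) (Var y))"
      using that by (auto simp: D_def orient_commute max_def)
    note simps = this bracketings_four orient_right orient_left top pr_def P_def Q_def R_def S_def
    show "P z y x + Q x y z + R z x y + S x y z + S z x y = 0"
      using expansion_zero_bracketings[OF p, of r "[d, x, y, z]", folded c_def]
      by (simp add: simps algebra_simps)
    show "P x z y + P z x y + P z y x + Q x y z + R x y z = 0"
      using expansion_zero_bracketings[OF p, of r "[x, d, y, z]", folded c_def]
      by (simp add: simps algebra_simps)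
  qed
  \<comment> \<open>adding the relations of the words \<open>d y z x\<close>, \<open>d y x z\<close>, \<open>d x y z\<close> and subtracting that of
    \<open>x d y z\<close> cancels the three coefficients \<open>P\<close>\<close>
  have key: "Q y x z + R z x y + S x y z + S y x z + S z x y = 0" if D: "D x y z" for x y z
  proof -
    note D' = Dp[OF D]
    have "2 * (Q y x z + R z x y + S x y z + S y x z + S z x y) =
        (P x z y + Q y z x + R x y z + S y z x + S x y z)
      + (P z x y + Q y x z + R z y x + S y x z + S z y x)
      + (P z y x + Q x y z + R z x y + S x y z + S z x y)
      - (P x z y + P z x y + P z y x + Q x y z + R x y z)"
      using sym[OF D'(2)] sym[OF D'(4)] by (simp add: algebra_simps)
    also have "\<dots> = 0"
      by (simp only: A[OF D'(3)] A[OF D'(2)] A[OF D] B[OF D]) simp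
    finally show ?thesis by (simp only: mult_eq_0_iff) simp
  qed
  have rel: "P x y z = S y x z \<and> Q x y z = Q y x z \<and>
      R x y z = - Q x y z - S x y z - S y x z - S z x y" if D: "D x y z" for x y z
  proof -
    note D' = Dp[OF D]
    note s = sym[OF D] sym[OF D'(2)] sym[OF D'(4)]
    have Q: "Q x y z = - (R z y x + S y x z + S x y z + S z y x)"
      "Q y x z = - (R z x y + S x y z + S y x z + S z x y)"
      "Q z y x = - (R x y z + S y z x + S z y x + S x y z)"
      "Q z x y = - (R y x z + S x z y + S z x y + S y x z)"
      "Q x z y = - (R y z x + S z x y + S x z y + S y z x)"
      using key[OF D'(2)] key[OF D] key[OF D'(3)] key[OF D'(1)] key[OF D'(4)]
      by (simp_all only: eq_neg_iff_add_eq_0 add.assoc)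
    have P: "P x y z = - (Q z y x + R x z y + S z y x + S x z y)"
      using A[OF D'(5)] by (simp only: eq_neg_iff_add_eq_0 add.assoc)
    have "P x y z = S y x z" unfolding P Q(3) s by (simp add: algebra_simps)
    moreover have "Q x y z = Q y x z" unfolding Q(1,2) s by (simp add: algebra_simps)
    moreover have "Q z x y = Q x z y" unfolding Q(4,5) s by (simp add: algebra_simps)
    then have "Q z y x = Q x y z" using s by simp
    then have "R x y z = - (Q x y z + S y z x + S z y x + S x y z)"
      using key[OF D'(3)] by (simp only: eq_neg_iff_add_eq_0) (simp only: ac_simps)
    then have "R x y z = - Q x y z - S x y z - S y x z - S z x y"
      using s by (simp add: algebra_simps)
    ultimately show ?thesis by blast
  qed
  have D: "D x y z" using top r by (simp add: D_def)
  from rel[OF D] show "c (Mul (Var x) (Mul (Var y) (Mul (Var z) (Var d)))) =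
      c (Mul (orient r (Var y) (pr x z)) (Var d))"
    and "c (Mul (pr y z) (Mul (Var x) (Var d))) = c (Mul (pr x z) (Mul (Var y) (Var d)))"
    and "c (Mul (Var x) (Mul (pr y z) (Var d))) = - c (Mul (pr y z) (Mul (Var x) (Var d)))
      - c (Mul (orient r (Var x) (pr y z)) (Var d))
      - c (Mul (orient r (Var y) (pr x z)) (Var d))
      - c (Mul (orient r (Var z) (pr x y)) (Var d))"
    by (simp_all add: P_def Q_def R_def S_def)
qed

text \<open>The ranking is chosen anew for each relation, so that it makes visible the monomials that the
  relation compares.\<close>

lemma kernel_relations:
  fixes p :: "('v, 'f::field_char_0) free_na"
  assumes p: "expansion p = 0" and xyzd: "distinct [x, y, z, d]"
  defines "c \<equiv> Poly_Mapping.lookup p"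
  defines "\<kappa> \<equiv> \<lambda>x y z. c (Mul (Mul (Var x) (Var y)) (Mul (Var z) (Var d)))"
    and "\<mu> \<equiv> \<lambda>x y z. c (Mul (Var x) (Mul (Var y) (Mul (Var z) (Var d))))"
  shows "\<kappa> y x z = \<kappa> x y z" and "\<kappa> x z y = \<kappa> x y z" and "\<mu> z y x = \<mu> x y z"
    and "c (Mul (Mul (Mul (Var x) (Var y)) (Var z)) (Var d)) = \<mu> x z y"
    and "c (Mul (Mul (Var x) (Mul (Var y) (Var z))) (Var d)) = \<mu> y x z"
    and "c (Mul (Var x) (Mul (Mul (Var y) (Var z)) (Var d))) =
      - \<kappa> x y z - \<mu> x y z - \<mu> y x z - \<mu> x z y"
proof -
  \<comment> \<open>the ranking \<open>a < b < c < d\<close>\<close>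
  define r where "r a b c = (\<lambda>_. 0 :: nat)(a := 1, b := 2, c := 3, d := 4)" for a b c
  define D where "D x y z \<longleftrightarrow> distinct [x, y, z, d]" for x y z
  have ranked: "r a b c a = 1" "r a b c b = 2" "r a b c c = 3" "r a b c d = 4"
    if "D a b c" for a b c
    using that by (auto simp: r_def D_def)
  note rel = kernel_relations_oriented[OF p, folded c_def]
  have \<mu>1: "\<mu> x y z = c (Mul (Mul (Mul (Var x) (Var z)) (Var y)) (Var d))"
    and \<mu>2: "\<mu> x y z = c (Mul (Mul (Var y) (Mul (Var x) (Var z))) (Var d))"
    and \<mu>3: "\<mu> z y x = c (Mul (Mul (Mul (Var x) (Var z)) (Var y)) (Var d))"
    and \<kappa>1: "\<kappa> x y z = \<kappa> x z y" and \<kappa>2: "\<kappa> x y z = \<kappa> z y x" if "D x y z" for x y z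
  proof -
    have D: "D x z y" "D y x z" using that by (auto simp: D_def)
    show "\<mu> x y z = c (Mul (Mul (Mul (Var x) (Var z)) (Var y)) (Var d))"
      using rel(1)[of "r x z y" x y z d] ranked[OF D(1)] that
      by (simp add: \<mu>_def D_def orient_def)
    show "\<mu> z y x = c (Mul (Mul (Mul (Var x) (Var z)) (Var y)) (Var d))"
      using rel(1)[of "r x z y" z y x d] ranked[OF D(1)] that
      by (auto simp: \<mu>_def D_def orient_def)
    show "\<mu> x y z = c (Mul (Mul (Var y) (Mul (Var x) (Var z))) (Var d))"
      using rel(1)[of "r y x z" x y z d] ranked[OF D(2)] that
      by (simp add: \<mu>_def D_def orient_def)
    show "\<kappa> x y z = \<kappa> x z y"
      using rel(2)[of "r x y z" z y x d] ranked[OF that] that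
      by (auto simp: \<kappa>_def D_def orient_def)
    show "\<kappa> x y z = \<kappa> z y x"
      using rel(2)[of "r x z y" z x y d] ranked[OF D(1)] that
      by (auto simp: \<kappa>_def D_def orient_def)
  qed
  have D: "D x y z" "D x z y" "D y x z" "D y z x" using xyzd by (auto simp: D_def)
  show "\<kappa> y x z = \<kappa> x y z" "\<kappa> x z y = \<kappa> x y z"
    using \<kappa>1[OF D(1)] \<kappa>2[OF D(2)] \<kappa>1[OF D(4)] by simp_all
  show "\<mu> z y x = \<mu> x y z" using \<mu>1[OF D(1)] \<mu>3[OF D(1)] by simp
  show "c (Mul (Mul (Mul (Var x) (Var y)) (Var z)) (Var d)) = \<mu> x z y"
    using \<mu>1[OF D(2)] by simp
  show "c (Mul (Mul (Var x) (Mul (Var y) (Var z))) (Var d)) = \<mu> y x z"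
    using \<mu>2[OF D(3)] by simp
  have R: "r y z x y = 1" "r y z x z = 2" "r y z x x = 3" "r y z x d = 4"
    using ranked[OF D(4)] by simp_all
  show "c (Mul (Var x) (Mul (Mul (Var y) (Var z)) (Var d))) =
      - \<kappa> x y z - \<mu> x y z - \<mu> y x z - \<mu> x z y"
    using rel(3)[of "r y z x" x y z d] rel(1)[of "r y z x" x y z d] rel(1)[of "r y z x" y x z d]
      rel(1)[of "r y z x" x z y d] \<kappa>2[OF D(2)] \<kappa>1[OF D(1)] R
    by (simp add: orient_def \<kappa>_def \<mu>_def)
qed

section \<open>Kernel elements as combinations of the two identities\<close>

abbreviation monomial :: "'v magma \<Rightarrow> ('v, 'f::field) free_na" where
  "monomial t \<equiv> Poly_Mapping.single t 1"

lemma na_mult_add: "(p + q) \<cdot> s = p \<cdot> s + q \<cdot> s" "s \<cdot> (p + q) = s \<cdot> p + s \<cdot> q"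
  using linear_bilin_ext_left[of Mul s] linear_bilin_ext_right[of Mul s]
  by (simp_all add: na_mult_def linear_iff)

lemma na_mult_monomial: "monomial s \<cdot> monomial t = monomial (Mul s t)"
  by (simp add: na_mult_def)

lemmas PJ_monomials = PJ1_def PJ2_def na_circ_def na_var_def na_mult_add na_mult_monomial

lemma magma_vars_nonempty [simp]: "magma_vars t \<noteq> []"
  by (induction t) auto

lemma magma_vars_one: "magma_vars t = [a] \<longleftrightarrow> t = Var a"
  by (cases t) (auto simp: append_eq_Cons_conv)

lemma magma_vars_two: "magma_vars t = [a, b] \<longleftrightarrow> t = Mul (Var a) (Var b)"
  by (cases t) (auto simp: append_eq_Cons_conv magma_vars_one)

lemma magma_vars_three:
  "magma_vars t = [a, b, c] \<longleftrightarrow>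
    t = Mul (Var a) (Mul (Var b) (Var c)) \<or> t = Mul (Mul (Var a) (Var b)) (Var c)"
  by (cases t) (auto simp: append_eq_Cons_conv magma_vars_one magma_vars_two)

lemma magma_vars_four:
  "magma_vars t = [a, b, c, d] \<longleftrightarrow>
    t \<in> {Mul (Var a) (Mul (Var b) (Mul (Var c) (Var d))),
      Mul (Mul (Var a) (Var b)) (Mul (Var c) (Var d)),
      Mul (Var a) (Mul (Mul (Var b) (Var c)) (Var d)),
      Mul (Mul (Mul (Var a) (Var b)) (Var c)) (Var d),
      Mul (Mul (Var a) (Mul (Var b) (Var c))) (Var d)}"
  by (cases t) (auto simp: append_eq_Cons_conv magma_vars_one magma_vars_two magma_vars_three)

definition distinct_tuples :: "('v \<times> 'v \<times> 'v \<times> 'v) set" where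
  "distinct_tuples = {(a, b, c, d). distinct [a, b, c, d]}"

text \<open>A multilinear monomial is determined by the order of its variables and one of the five bracketings.\<close>

lemma multilinear_expand:
  fixes p :: "('v, 'f::field) free_na"
  assumes card: "card (UNIV :: 'v set) = 4" and p: "p \<in> na_multilinear"
  defines "m \<equiv> \<lambda>t. fv_scale (Poly_Mapping.lookup p t) (monomial t)"
  shows "p = (\<Sum>(a, b, c, d)\<in>distinct_tuples.
      m (Mul (Var a) (Mul (Var b) (Mul (Var c) (Var d)))) +
      m (Mul (Mul (Var a) (Var b)) (Mul (Var c) (Var d))) +
      m (Mul (Var a) (Mul (Mul (Var b) (Var c)) (Var d))) +
      m (Mul (Mul (Mul (Var a) (Var b)) (Var c)) (Var d)) +
      m (Mul (Mul (Var a) (Mul (Var b) (Var c))) (Var d)))"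
proof -
  define T where "T \<tau> = {t. magma_vars t = (case \<tau> of (a, b, c, d) \<Rightarrow> [a, b, c, d :: 'v])}" for \<tau>
  have T: "T (a, b, c, d) = {Mul (Var a) (Mul (Var b) (Mul (Var c) (Var d))),
      Mul (Mul (Var a) (Var b)) (Mul (Var c) (Var d)),
      Mul (Var a) (Mul (Mul (Var b) (Var c)) (Var d)),
      Mul (Mul (Mul (Var a) (Var b)) (Var c)) (Var d),
      Mul (Mul (Var a) (Mul (Var b) (Var c))) (Var d)}" for a b c d
    by (simp only: T_def prod.case magma_vars_four Collect_mem_eq)
  have fin_T: "finite (T \<tau>)" for \<tau>
    by (cases \<tau>) (simp add: T)
  have "finite (UNIV :: 'v set)" using card by (simp add: card_ge_0_finite)
  then have "finite (UNIV :: ('v \<times> 'v \<times> 'v \<times> 'v) set)" by (simp add: finite_prod)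
  then have fin: "finite (distinct_tuples :: ('v \<times> 'v \<times> 'v \<times> 'v) set)"
    by (rule finite_subset[OF subset_UNIV])
  have keys: "Poly_Mapping.keys p \<subseteq> (\<Union>\<tau>\<in>distinct_tuples. T \<tau>)"
  proof
    fix t assume "t \<in> Poly_Mapping.keys p"
    then have t: "distinct (magma_vars t)" "set (magma_vars t) = UNIV"
      using p by (auto simp: na_multilinear_def)
    then have "length (magma_vars t) = 4" using card distinct_card by metis
    then obtain a b c d where "magma_vars t = [a, b, c, d]"
      by (auto simp: length_Suc_conv numeral_eq_Suc)
    then show "t \<in> (\<Union>\<tau>\<in>distinct_tuples. T \<tau>)"
      using t(1) by (intro UN_I[of "(a, b, c, d)"]) (simp_all add: T_def distinct_tuples_def)
  qed
  have "p = (\<Sum>t\<in>(\<Union>\<tau>\<in>distinct_tuples. T \<tau>). m t)"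
    using fv_expansion[of p] lin_ext_superset[OF vector_space_fv _ keys, of monomial] fin fin_T
    by (simp add: m_def)
  also have "\<dots> = (\<Sum>\<tau>\<in>distinct_tuples. \<Sum>t\<in>T \<tau>. m t)"
    by (rule sum.UNION_disjoint) (auto simp: T_def fin fin_T[unfolded T_def])
  also have "\<dots> = (\<Sum>(a, b, c, d)\<in>distinct_tuples.
      m (Mul (Var a) (Mul (Var b) (Mul (Var c) (Var d)))) +
      m (Mul (Mul (Var a) (Var b)) (Mul (Var c) (Var d))) +
      m (Mul (Var a) (Mul (Mul (Var b) (Var c)) (Var d))) +
      m (Mul (Mul (Mul (Var a) (Var b)) (Var c)) (Var d)) +
      m (Mul (Mul (Var a) (Mul (Var b) (Var c))) (Var d)))"
    by (rule sum.cong) (auto simp: T add.assoc)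
  finally show ?thesis .
qed

lemma sum_tuples_permute:
  "(\<Sum>(a, b, c, d)\<in>distinct_tuples. G a b c d) = (\<Sum>(a, b, c, d)\<in>distinct_tuples. G b a c d)"
  "(\<Sum>(a, b, c, d)\<in>distinct_tuples. G a b c d) = (\<Sum>(a, b, c, d)\<in>distinct_tuples. G a c b d)"
  by (rule sum.reindex_bij_witness[where i = "\<lambda>(a, b, c, d). (b, a, c, d)" and j = "\<lambda>(a, b, c, d). (b, a, c, d)"],
      auto simp: distinct_tuples_def)
     (rule sum.reindex_bij_witness[where i = "\<lambda>(a, b, c, d). (a, c, b, d)" and j = "\<lambda>(a, b, c, d). (a, c, b, d)"],
      auto simp: distinct_tuples_def)

lemma sum_tuples_average:
  fixes G :: "'v \<Rightarrow> 'v \<Rightarrow> 'v \<Rightarrow> 'v \<Rightarrow> ('v, 'f::field_char_0) free_na"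
  shows "(\<Sum>(a, b, c, d)\<in>distinct_tuples. G a b c d) = fv_scale (1 / 6) (\<Sum>(a, b, c, d)\<in>distinct_tuples.
    G a b c d + G a c b d + G b a c d + G b c a d + G c a b d + G c b a d)"
proof -
  let ?s = "\<lambda>G. \<Sum>(a, b, c, d)\<in>distinct_tuples. G a b c d :: ('v, 'f) free_na"
  have swap1: "?s (\<lambda>a b c d. H b a c d) = ?s H" and swap2: "?s (\<lambda>a b c d. H a c b d) = ?s H" for H
    using sum_tuples_permute[of H] by simp_all
  have *: "?s (\<lambda>a b c d. G a c b d) = ?s G" "?s (\<lambda>a b c d. G b a c d) = ?s G"
    by (rule swap2, rule swap1)
  have **: "?s (\<lambda>a b c d. G b c a d) = ?s G" "?s (\<lambda>a b c d. G c a b d) = ?s G"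
    using swap1[of "\<lambda>a b c d. G a c b d"] swap2[of "\<lambda>a b c d. G b a c d"] * by simp_all
  have ***: "?s (\<lambda>a b c d. G c b a d) = ?s G"
    using swap1[of "\<lambda>a b c d. G c a b d"] ** by simp
  have "?s (\<lambda>a b c d. G a b c d + G a c b d + G b a c d + G b c a d + G c a b d + G c b a d) =
      ?s G + ?s G + ?s G + ?s G + ?s G + ?s G"
    using * ** *** by (simp only: case_prod_unfold sum.distrib)
  also have "\<dots> = fv_scale 6 (?s G)"
    by (rule poly_mapping_eqI) (simp add: Poly_Mapping.lookup_add)
  finally show ?thesis by simp
qed

text \<open>By \<open>kernel_relations\<close>, \<open>p\<close> is the sum of the elements \<open>K x y z d\<close> over all orders of the variables.
  Replacing each by its average over the six orders of \<open>x, y, z\<close> completes the symmetric sums in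
  \<open>PJ1\<close>, which is symmetric in all three, and in the three versions of \<open>PJ2\<close>, one for each middle
  variable.\<close>

lemma kernel_as_PJ_sum:
  fixes p :: "('v, 'f::field_char_0) free_na"
  assumes card: "card (UNIV :: 'v set) = 4" and p: "p \<in> expansion_kernel"
  defines "c \<equiv> Poly_Mapping.lookup p"
  defines "\<kappa> \<equiv> \<lambda>x y z d. c (Mul (Mul (Var x) (Var y)) (Mul (Var z) (Var d)))"
    and "\<mu> \<equiv> \<lambda>x y z d. c (Mul (Var x) (Mul (Var y) (Mul (Var z) (Var d))))"
  shows "p = fv_scale (1 / 6) (\<Sum>(x, y, z, d)\<in>distinct_tuples.
      fv_scale (\<kappa> x y z d) (PJ1 (na_var x) (na_var y) (na_var z) (na_var d)) +
      fv_scale (\<mu> x y z d) (PJ2 (na_var x) (na_var y) (na_var z) (na_var d)) +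
      fv_scale (\<mu> y x z d) (PJ2 (na_var y) (na_var x) (na_var z) (na_var d)) +
      fv_scale (\<mu> x z y d) (PJ2 (na_var x) (na_var z) (na_var y) (na_var d)))"
proof -
  define K where "K x y z d =
      fv_scale (\<kappa> x y z d) (monomial (Mul (Mul (Var x) (Var y)) (Mul (Var z) (Var d)))) +
      fv_scale (\<mu> x y z d) (monomial (Mul (Var x) (Mul (Var y) (Mul (Var z) (Var d))))) +
      fv_scale (\<mu> x z y d) (monomial (Mul (Mul (Mul (Var x) (Var y)) (Var z)) (Var d))) +
      fv_scale (\<mu> y x z d) (monomial (Mul (Mul (Var x) (Mul (Var y) (Var z))) (Var d))) +
      fv_scale (- \<kappa> x y z d - \<mu> x y z d - \<mu> y x z d - \<mu> x z y d)
        (monomial (Mul (Var x) (Mul (Mul (Var y) (Var z)) (Var d))))" for x y z d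
  have p': "p \<in> na_multilinear" "expansion p = 0"
    using p by (auto simp: expansion_kernel_def)
  note rel = kernel_relations[OF p'(2), folded c_def]
  have "p = (\<Sum>(x, y, z, d)\<in>distinct_tuples. K x y z d)"
    by (subst multilinear_expand[OF card p'(1)], rule sum.cong)
      (auto simp: distinct_tuples_def K_def rel \<kappa>_def \<mu>_def c_def[symmetric] ac_simps)
  also have "\<dots> = fv_scale (1 / 6) (\<Sum>(x, y, z, d)\<in>distinct_tuples.
      K x y z d + K x z y d + K y x z d + K y z x d + K z x y d + K z y x d)"
    by (rule sum_tuples_average)
  also have "(\<Sum>(x, y, z, d)\<in>distinct_tuples.
      K x y z d + K x z y d + K y x z d + K y z x d + K z x y d + K z y x d) =
    (\<Sum>(x, y, z, d)\<in>distinct_tuples.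
      fv_scale (\<kappa> x y z d) (PJ1 (na_var x) (na_var y) (na_var z) (na_var d)) +
      fv_scale (\<mu> x y z d) (PJ2 (na_var x) (na_var y) (na_var z) (na_var d)) +
      fv_scale (\<mu> y x z d) (PJ2 (na_var y) (na_var x) (na_var z) (na_var d)) +
      fv_scale (\<mu> x z y d) (PJ2 (na_var x) (na_var z) (na_var y) (na_var d)))"
  proof (rule sum.cong[OF refl], safe)
    fix x y z d :: 'v assume "(x, y, z, d) \<in> distinct_tuples"
    then have D: "distinct [x, y, z, d]" "distinct [x, z, y, d]" "distinct [y, x, z, d]"
      "distinct [y, z, x, d]" by (auto simp: distinct_tuples_def)
    have swap: "\<kappa> b a e d = \<kappa> a b e d" "\<kappa> a e b d = \<kappa> a b e d" "\<mu> e b a d = \<mu> a b e d"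
      if "distinct [a, b, e, d]" for a b e
      using rel(1-3)[OF that] by (simp_all add: \<kappa>_def \<mu>_def)
    have "\<kappa> x z y d = \<kappa> x y z d" "\<kappa> y x z d = \<kappa> x y z d" "\<kappa> y z x d = \<kappa> x y z d"
      "\<kappa> z x y d = \<kappa> x y z d" "\<kappa> z y x d = \<kappa> x y z d"
      "\<mu> z y x d = \<mu> x y z d" "\<mu> z x y d = \<mu> y x z d" "\<mu> y z x d = \<mu> x z y d"
      using swap(1)[OF D(1)] swap(2)[OF D(1)] swap(2)[OF D(3)] swap(1)[OF D(2)] swap(1)[OF D(4)]
        swap(3)[OF D(1)] swap(3)[OF D(3)] swap(3)[OF D(2)] by simp_all
    note eqs = this
    show "K x y z d + K x z y d + K y x z d + K y z x d + K z x y d + K z y x d =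
      fv_scale (\<kappa> x y z d) (PJ1 (na_var x) (na_var y) (na_var z) (na_var d)) +
      fv_scale (\<mu> x y z d) (PJ2 (na_var x) (na_var y) (na_var z) (na_var d)) +
      fv_scale (\<mu> y x z d) (PJ2 (na_var y) (na_var x) (na_var z) (na_var d)) +
      fv_scale (\<mu> x z y d) (PJ2 (na_var x) (na_var z) (na_var y) (na_var d))"
      unfolding K_def PJ_monomials eqs FV.scale_right_distrib FV.scale_right_diff_distrib
        FV.scale_left_distrib FV.scale_left_diff_distrib FV.scale_minus_left
      by (simp del: fv_scale_single add: algebra_simps)
  qed
  finally show ?thesis .
qed

section \<open>The kernel as a permutation module\<close>

lemma linear_na_permute: "Vector_Spaces.linear fv_scale fv_scale (na_permute \<pi>)"
  unfolding na_permute_def by (rule linear_lin_ext[OF vector_space_fv])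

lemma na_permute_monomial: "na_permute \<pi> (monomial t) = monomial (map_magma \<pi> t)"
  by (simp add: na_permute_def vector_space_fv)

lemma na_permute_add: "na_permute \<pi> (p + q) = na_permute \<pi> p + na_permute \<pi> q"
  and na_permute_diff: "na_permute \<pi> (p - q) = na_permute \<pi> p - na_permute \<pi> q"
proof -
  interpret Vector_Spaces.linear fv_scale fv_scale "na_permute \<pi>" by (rule linear_na_permute)
  show "na_permute \<pi> (p + q) = na_permute \<pi> p + na_permute \<pi> q"
    "na_permute \<pi> (p - q) = na_permute \<pi> p - na_permute \<pi> q"
    by (rule add diff)+
qed

lemma na_permute_PJ:
  "na_permute \<pi> (PJ1 (na_var x) (na_var y) (na_var z) (na_var u)) =
    PJ1 (na_var (\<pi> x)) (na_var (\<pi> y)) (na_var (\<pi> z)) (na_var (\<pi> u))"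
  "na_permute \<pi> (PJ2 (na_var x) (na_var y) (na_var z) (na_var u)) =
    PJ2 (na_var (\<pi> x)) (na_var (\<pi> y)) (na_var (\<pi> z)) (na_var (\<pi> u))"
  by (simp_all add: PJ_monomials na_permute_add na_permute_diff na_permute_monomial)

lemma magma_vars_map: "magma_vars (map_magma \<pi> t) = map \<pi> (magma_vars t)"
  by (induction t) auto

lemma subspace_na_multilinear: "FV.subspace (na_multilinear :: ('v, 'f::field) free_na set)"
  unfolding FV.subspace_def
proof (intro conjI ballI allI)
  fix p q :: "('v, 'f) free_na" and c assume *: "p \<in> na_multilinear"
  show "fv_scale c p \<in> na_multilinear"
    using * by (auto simp: na_multilinear_def in_keys_iff)
  assume "q \<in> na_multilinear"
  then show "p + q \<in> na_multilinear"
    using * Poly_Mapping.keys_add[of p q] by (auto simp: na_multilinear_def)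
qed (simp add: na_multilinear_def)

lemma subspace_expansion_kernel: "FV.subspace (expansion_kernel :: ('v, 'f::field) free_na set)"
proof -
  interpret E: Vector_Spaces.linear fv_scale fd_scale "expansion :: ('v, 'f) free_na \<Rightarrow> _"
    by (rule linear_expansion)
  show ?thesis
    using subspace_na_multilinear
    unfolding FV.subspace_def expansion_kernel_def by (auto simp: E.add E.scale E.zero)
qed

text \<open>Renaming variables extends to an endomorphism of the free dendriform algebra, which intertwines
  the expansions.\<close>

lemma expansion_permute:
  fixes p :: "('v, 'f::field) free_na"
  assumes "expansion p = 0"
  shows "expansion (na_permute \<pi> p) = 0"
proof -
  obtain h :: "('v, 'f) free_dend \<Rightarrow> ('v, 'f) free_dend"
    where lin: "Vector_Spaces.linear fd_scale fd_scale h" and var: "\<And>v. h (fd_var v) = fd_var (\<pi> v)"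
      and succ: "\<And>p q. h (p \<succ> q) = h p \<succ> h q" and prec: "\<And>p q. h (p \<prec> q) = h p \<prec> h q"
    using FD.free_dend_universal[of "\<lambda>v. fd_var (\<pi> v)"] by blast
  interpret h: Vector_Spaces.linear fd_scale fd_scale h by (rule lin)
  have "h (magma_eval prejordan fd_var t) = magma_eval prejordan fd_var (map_magma \<pi> t)" for t
    by (induction t) (simp_all add: var prejordan_def h.add succ prec)
  then have "h (expansion (monomial t)) = expansion (na_permute \<pi> (monomial t))" for t
    by (simp add: na_permute_monomial expansion_def vector_space_fd)
  then have "expansion (na_permute \<pi> p) = h (expansion p)"
    using linear_eq_lin_ext[OF linear_compose2[OF linear_expansion lin], of p]
      linear_eq_lin_ext[OF linear_compose2[OF linear_na_permute linear_expansion], of \<pi> p] by simp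
  then show ?thesis by (simp add: assms h.zero)
qed

lemma perm_submodule_expansion_kernel:
  "perm_submodule (expansion_kernel :: ('v, 'f::field) free_na set)"
  unfolding perm_submodule_def
proof (intro conjI subspace_expansion_kernel allI impI ballI)
  fix \<pi> :: "'v \<Rightarrow> 'v" and p :: "('v, 'f) free_na" assume \<pi>: "bij \<pi>" and p: "p \<in> expansion_kernel"
  have "na_permute \<pi> p \<in> na_multilinear"
    unfolding na_permute_def lin_ext_def
  proof (intro FV.subspace_sum[OF subspace_na_multilinear] FV.subspace_scale[OF subspace_na_multilinear])
    fix t assume "t \<in> Poly_Mapping.keys p"
    then have "distinct (magma_vars t)" "set (magma_vars t) = UNIV"
      using p by (auto simp: expansion_kernel_def na_multilinear_def)
    then show "monomial (map_magma \<pi> t) \<in> na_multilinear"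
      using \<pi> by (auto simp: na_multilinear_def magma_vars_map distinct_map bij_def inj_on_def)
  qed
  with p show "na_permute \<pi> p \<in> expansion_kernel"
    by (simp add: expansion_kernel_def expansion_permute)
qed

lemma PJ_multilinear:
  assumes "distinct [x, y, z, u]" and "UNIV = {x, y, z, u}"
  shows "PJ1 (na_var x) (na_var y) (na_var z) (na_var u) \<in> na_multilinear"
    and "PJ2 (na_var x) (na_var y) (na_var z) (na_var u) \<in> na_multilinear"
proof -
  note S = subspace_na_multilinear
  have M: "monomial t \<in> na_multilinear" if "mset (magma_vars t) = mset [x, y, z, u]" for t
    using mset_eq_imp_distinct_iff[OF that] mset_eq_setD[OF that] assms
    by (simp add: na_multilinear_def)
  show "PJ1 (na_var x) (na_var y) (na_var z) (na_var u) \<in> na_multilinear"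
    "PJ2 (na_var x) (na_var y) (na_var z) (na_var u) \<in> na_multilinear"
    unfolding PJ_monomials by (intro FV.subspace_add[OF S] FV.subspace_diff[OF S] M; simp)+
qed

lemma fd_add:
  "(p + q) \<succ> x = p \<succ> x + q \<succ> x" "x \<succ> (p + q) = x \<succ> p + x \<succ> q"
  "(p + q) \<prec> x = p \<prec> x + q \<prec> x" "x \<prec> (p + q) = x \<prec> p + x \<prec> q"
  for p q x :: "('v, 'f::field) free_dend"
  using FD.succ_linear_left FD.succ_linear_right FD.prec_linear_left FD.prec_linear_right
  unfolding linear_iff by blast+

text \<open>Used from left to right, the dendriform laws leave neither a product \<open>x \<prec> y\<close> whose left factor is
  a product, nor an \<open>x \<succ> (y \<succ> z)\<close>. In this normal form all terms cancel.\<close>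

lemma expansion_PJ:
  "expansion (PJ1 x y z u) = 0" "expansion (PJ2 x y z u) = 0"
proof -
  interpret E: Vector_Spaces.linear fv_scale fd_scale expansion by (rule linear_expansion)
  show "expansion (PJ1 x y z u) = 0" "expansion (PJ2 x y z u) = 0"
    by (simp_all add: PJ1_def PJ2_def na_circ_def E.add E.diff expansion_na_mult prejordan_def fd_add
      FD.dend1 FD.dend2 FD.dend3 algebra_simps)
qed

theorem theorem4p1:
  fixes x y z u :: 'v
  assumes "distinct [x, y, z, u]" and "UNIV = {x, y, z, u}"
  shows "(expansion_kernel :: ('v, 'f::field_char_0) free_na set) =
    perm_module_generated
      {PJ1 (na_var x) (na_var y) (na_var z) (na_var u),
       PJ2 (na_var x) (na_var y) (na_var z) (na_var u)}"
    (is "_ = perm_module_generated ?G")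
proof
  show "perm_module_generated ?G \<subseteq> expansion_kernel"
    unfolding perm_module_generated_def
  proof (rule hull_minimal)
    show "?G \<subseteq> expansion_kernel"
      by (simp add: expansion_kernel_def PJ_multilinear[OF assms] expansion_PJ)
  qed (rule perm_submodule_expansion_kernel)
  have "p \<in> M" if p: "p \<in> expansion_kernel" and M: "perm_submodule M" and G: "?G \<subseteq> M"
    for p :: "('v, 'f) free_na" and M
  proof -
    have sub: "FV.subspace M" using M by (simp add: perm_submodule_def)
    have card: "card (UNIV :: 'v set) = 4" unfolding assms(2) using assms(1) by simp
    have PJ: "PJ1 (na_var a) (na_var b) (na_var c) (na_var d) \<in> M"
      "PJ2 (na_var a) (na_var b) (na_var c) (na_var d) \<in> M"
      if "distinct [a, b, c, d]" for a b c d
    proof -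
      define \<pi> where "\<pi> v = (if v = x then a else if v = y then b else if v = z then c else d)" for v
      have \<pi>: "\<pi> x = a" "\<pi> y = b" "\<pi> z = c" "\<pi> u = d" using assms(1) by (auto simp: \<pi>_def)
      have "inj \<pi>"
        unfolding assms(2) using that assms(1) by (auto simp: \<pi>)
      moreover have "finite (UNIV :: 'v set)" unfolding assms(2) by simp
      ultimately have "bij \<pi>" by (simp add: bij_def finite_UNIV_inj_surj)
      then have "na_permute \<pi> q \<in> M" if "q \<in> M" for q using M that by (auto simp: perm_submodule_def)
      then show "PJ1 (na_var a) (na_var b) (na_var c) (na_var d) \<in> M"
        "PJ2 (na_var a) (na_var b) (na_var c) (na_var d) \<in> M"
        using G na_permute_PJ[of \<pi> x y z u, unfolded \<pi>] by (metis insert_subset)+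
    qed
    show "p \<in> M"
      by (subst kernel_as_PJ_sum[OF card p])
        (auto simp: distinct_tuples_def intro!: FV.subspace_scale[OF sub] FV.subspace_sum[OF sub]
          FV.subspace_add[OF sub] PJ)
  qed
  then show "expansion_kernel \<subseteq> perm_module_generated ?G"
    by (auto simp: perm_module_generated_def hull_def)
qed

end
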